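(* Let $m\ge 1$ and let $A,B\in\mathcal B(\mathbb C^m)$ be traceless Hermitian operators. Set $\Delta=A-B$, let $P_+$ (resp. $P_-$) be the orthogonal projector onto the span of the eigenvectors of $\Delta$ with strictly positive (resp. strictly negative) eigenvalues, and let $P_0=I-P_+-P_-$ be the projector onto $\ker\Delta$. Let $d\ge 2$. Then there exists a completely positive trace-preserving (CPTP) map $\lambda:\mathcal B(\mathbb C^m)\to\mathcal B(\mathbb C^d)$ such that $$\|\lambda(A)\|_1-\|\lambda(B)\|_1=\|\lambda(A-B)\|_1=\|A-B\|_1$$ if and only if there exists an operator $E_0$ with $0\le E_0\le P_0$ satisfying $$\operatorname{Tr}(P_+A)+\operatorname{Tr}(E_0A)\;\ge\;\operatorname{Tr}(P_+B)+\operatorname{Tr}(E_0B)\;\ge\;0.$$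
   Context: $\|X\|_1=\operatorname{Tr}\sqrt{X^\dagger X}$ denotes the trace norm. Operator inequalities $0\le E_0\le P_0$ are in the Loewner (positive semidefinite) order. *)

theory Defs
  imports "Jordan_Normal_Form.Matrix"
begin

definition trace :: "complex mat \<Rightarrow> complex" where
  "trace A = (\<Sum>i<dim_row A. A $$ (i,i))"

definition adj :: "complex mat \<Rightarrow> complex mat" where
  "adj A = mat (dim_col A) (dim_row A) (\<lambda>(i,j). cnj (A $$ (j,i)))"

definition hermitian :: "nat \<Rightarrow> complex mat \<Rightarrow> bool" where
  "hermitian n A \<longleftrightarrow> A \<in> carrier_mat n n \<and> adj A = A"

definition cinner :: "complex vec \<Rightarrow> complex vec \<Rightarrow> complex" where
  "cinner v w = (\<Sum>i<dim_vec v. cnj (v $ i) * w $ i)"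

definition psd :: "nat \<Rightarrow> complex mat \<Rightarrow> bool" where
  "psd n A \<longleftrightarrow> hermitian n A \<and>
     (\<forall>v \<in> carrier_vec n. 0 \<le> Re (cinner v (A *\<^sub>v v)))"

text \<open>Trace norm ||X||_1 = Tr sqrt(X^dagger X), sqrt = the unique psd square root.\<close>
definition trace_norm :: "nat \<Rightarrow> complex mat \<Rightarrow> real" where
  "trace_norm n X = Re (trace (THE S. psd n S \<and> S * S = adj X * X))"

definition eig_span :: "nat \<Rightarrow> (real \<Rightarrow> bool) \<Rightarrow> complex mat \<Rightarrow> complex vec set" where
  "eig_span n Q D = {foldr (+) vs (0\<^sub>v n) | vs. \<forall>v \<in> set vs. v \<in> carrier_vec n \<and>
       (\<exists>l. Q l \<and> D *\<^sub>v v = complex_of_real l \<cdot>\<^sub>v v)}"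

definition orth_proj :: "nat \<Rightarrow> complex vec set \<Rightarrow> complex mat" where
  "orth_proj n W = (THE P. hermitian n P \<and> P * P = P \<and>
      {P *\<^sub>v v | v. v \<in> carrier_vec n} = W)"

definition P_plus :: "nat \<Rightarrow> complex mat \<Rightarrow> complex mat" where
  "P_plus n D = orth_proj n (eig_span n (\<lambda>l. l > 0) D)"

definition P_minus :: "nat \<Rightarrow> complex mat \<Rightarrow> complex mat" where
  "P_minus n D = orth_proj n (eig_span n (\<lambda>l. l < 0) D)"

definition P_zero :: "nat \<Rightarrow> complex mat \<Rightarrow> complex mat" where
  "P_zero n D = 1\<^sub>m n - P_plus n D - P_minus n D"

definition block :: "nat \<Rightarrow> complex mat \<Rightarrow> nat \<Rightarrow> nat \<Rightarrow> complex mat" where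
  "block m M bi bj = mat m m (\<lambda>(r,c). M $$ (bi * m + r, bj * m + c))"

text \<open>The amplification id_k \<otimes> f : B(C^k \<otimes> C^m) -> B(C^k \<otimes> C^d), acting blockwise.\<close>
definition amplify :: "nat \<Rightarrow> nat \<Rightarrow> nat \<Rightarrow> (complex mat \<Rightarrow> complex mat) \<Rightarrow> complex mat \<Rightarrow> complex mat" where
  "amplify k m d f M = mat (k * d) (k * d)
     (\<lambda>(i,j). f (block m M (i div d) (j div d)) $$ (i mod d, j mod d))"

definition cptp :: "nat \<Rightarrow> nat \<Rightarrow> (complex mat \<Rightarrow> complex mat) \<Rightarrow> bool" where
  "cptp m d f \<longleftrightarrow>
     (\<forall>X \<in> carrier_mat m m. f X \<in> carrier_mat d d) \<and>
     (\<forall>X \<in> carrier_mat m m. \<forall>Y \<in> carrier_mat m m. \<forall>a. f (a \<cdot>\<^sub>m X + Y) = a \<cdot>\<^sub>m f X + f Y) \<and>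
     (\<forall>X \<in> carrier_mat m m. trace (f X) = trace X) \<and>
     (\<forall>k. \<forall>M. psd (k * m) M \<longrightarrow> psd (k * d) (amplify k m d f M))"

end

theory Submission
  imports Defs "Jordan_Normal_Form.Spectral_Radius"
begin

text \<open>
  For a traceless Hermitian operator X and an effect F, that is \<open>0 \<le> F \<le> 1\<close>, one has
  \<open>Tr (F X) \<le> ||X||/2\<close>, and the projector onto the positive part of X attains the bound.
  Given a channel f with the required property, test \<open>f A\<close>, \<open>f B\<close> and \<open>f (A - B)\<close> against the positive
  projector F of \<open>f A\<close>: the bounds for B and \<open>A - B\<close> must both be attained. The effect E dual to F under f
  then attains the bound for \<open>A - B\<close>, which forces E to be the identity on the positive eigenspaces of
  \<open>A - B\<close> and zero on the negative ones, so \<open>E0 = E - P+\<close> lies between 0 and \<open>P0\<close>.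
  Conversely, the two-outcome measurement with effect \<open>E = P+ + E0\<close>, with its outcome recorded
  in two orthogonal states, maps a traceless Hermitian X to an operator of trace norm \<open>2 |Tr (E X)|\<close>.
\<close>

section \<open>Adjoints, inner products and traces\<close>

text \<open>The trace norm and the spectral projectors are definite descriptions, so each has to be
  evaluated before it can be estimated. Operators are therefore written in an orthonormal
  eigenbasis, and uniqueness of the psd square root and of the projector onto a given subspace does
  the evaluation. \<open>Tr (E D)\<close> with \<open>D = A - B\<close> sees only the diagonal of E
  in an eigenbasis of D, whereas the claim about \<open>E - P+\<close> concerns all of E. Positivity
  closes this gap: a psd T with \<open><v, T v> = 0\<close> satisfies \<open>T v = 0\<close>, so a
  diagonal entry of E with the extreme value 0 or 1 determines the action of E on that basis vector.
  \<open>E0\<close> is the freedom left on the kernel of D: it does not change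
  \<open>Tr (E D)\<close>, but it shifts \<open>Tr (E A)\<close> and \<open>Tr (E B)\<close> by the
  same amount. The two inequalities say \<open>Tr (E A) \<ge> Tr (E B) \<ge> 0\<close>, which
  removes the absolute values from \<open>2 |Tr (E X)|\<close>; the difference of the two output
  norms is then \<open>2 Tr (E D)\<close>.\<close>

lemma adj_dim[simp]: "dim_row (adj A) = dim_col A" "dim_col (adj A) = dim_row A"
  by (simp_all add: adj_def)

lemma adj_carrier[simp]: "A \<in> carrier_mat n m \<Longrightarrow> adj A \<in> carrier_mat m n"
  by (auto simp: adj_def)

lemma adj_carrier_iff[simp]: "adj A \<in> carrier_mat n m \<longleftrightarrow> A \<in> carrier_mat m n"
  unfolding carrier_mat_def by auto

lemma mult_carrier_mat_iff[simp]: "A * B \<in> carrier_mat n m \<longleftrightarrow> dim_row A = n \<and> dim_col B = m"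
  unfolding carrier_mat_def by auto

lemma index_adj[simp]: "i < dim_col A \<Longrightarrow> j < dim_row A \<Longrightarrow> adj A $$ (i,j) = cnj (A $$ (j,i))"
  by (simp add: adj_def)

lemma adj_adj[simp]: "adj (adj A) = A"
  by (rule eq_matI) auto

lemma index_mult_mat_sum:
  fixes A B :: "complex mat"
  assumes "A \<in> carrier_mat n m" "B \<in> carrier_mat m p" "i < n" "j < p"
  shows "(A * B) $$ (i,j) = (\<Sum>k<m. A $$ (i,k) * B $$ (k,j))"
  using assms by (auto simp: scalar_prod_def lessThan_atLeast0 intro!: sum.cong)

lemma index_mult_vec_sum:
  fixes A :: "complex mat"
  assumes "A \<in> carrier_mat n m" "v \<in> carrier_vec m" "i < n"
  shows "(A *\<^sub>v v) $ i = (\<Sum>k<m. A $$ (i,k) * v $ k)"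
  using assms by (auto simp: scalar_prod_def lessThan_atLeast0 intro!: sum.cong)

lemma adj_mult:
  assumes "A \<in> carrier_mat n m" "B \<in> carrier_mat m p"
  shows "adj (A * B) = adj B * adj A"
proof (rule eq_matI)
  fix i j assume "i < dim_row (adj B * adj A)" "j < dim_col (adj B * adj A)"
  hence i: "i < p" and j: "j < n" using assms by auto
  have "adj (A * B) $$ (i,j) = cnj ((A * B) $$ (j,i))" using assms i j by auto
  also have "\<dots> = (\<Sum>k<m. adj B $$ (i,k) * adj A $$ (k,j))"
    unfolding index_mult_mat_sum[OF assms j i] using assms i j
    by (auto simp: mult.commute intro!: sum.cong)
  also have "\<dots> = (adj B * adj A) $$ (i,j)"
    by (rule index_mult_mat_sum[symmetric, of _ p m _ n]) (use assms i j in auto)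
  finally show "adj (A * B) $$ (i,j) = (adj B * adj A) $$ (i,j)" .
qed (use assms in auto)

lemma adj_add: "A \<in> carrier_mat n m \<Longrightarrow> B \<in> carrier_mat n m \<Longrightarrow> adj (A + B) = adj A + adj B"
  by (rule eq_matI) auto

lemma adj_minus: "A \<in> carrier_mat n m \<Longrightarrow> B \<in> carrier_mat n m \<Longrightarrow> adj (A - B) = adj A - adj B"
  by (rule eq_matI) auto

lemma adj_one[simp]: "adj (1\<^sub>m n) = 1\<^sub>m n"
  by (rule eq_matI) auto

lemma cinner_sum: "v \<in> carrier_vec n \<Longrightarrow> cinner v w = (\<Sum>i<n. cnj (v $ i) * w $ i)"
  by (auto simp: cinner_def)

lemma cinner_mult_vec:
  assumes "A \<in> carrier_mat n m" "v \<in> carrier_vec n" "w \<in> carrier_vec m"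
  shows "cinner v (A *\<^sub>v w) = (\<Sum>i<n. \<Sum>j<m. cnj (v $ i) * A $$ (i,j) * w $ j)"
  unfolding cinner_sum[OF assms(2)]
  by (rule sum.cong) (auto simp: index_mult_vec_sum[OF assms(1,3)] sum_distrib_left mult.assoc)

lemma cinner_adj:
  assumes "A \<in> carrier_mat n m" "v \<in> carrier_vec n" "w \<in> carrier_vec m"
  shows "cinner v (A *\<^sub>v w) = cinner (adj A *\<^sub>v v) w"
proof -
  have "cinner (adj A *\<^sub>v v) w = (\<Sum>j<m. \<Sum>i<n. cnj (v $ i) * A $$ (i,j) * w $ j)"
    unfolding cinner_sum[OF mult_mat_vec_carrier[OF adj_carrier[OF assms(1)] assms(2)]]
    by (rule sum.cong)
      (use assms in \<open>auto simp: index_mult_vec_sum[OF adj_carrier[OF assms(1)] assms(2)]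
         sum_distrib_right sum_distrib_left ac_simps simp del: index_mult_mat_vec intro!: sum.cong\<close>)
  thus ?thesis unfolding cinner_mult_vec[OF assms] by (simp add: sum.swap[of _ "{..<n}"])
qed

lemma cinner_commute:
  assumes "v \<in> carrier_vec n" "w \<in> carrier_vec n"
  shows "cinner w v = cnj (cinner v w)"
  using assms by (auto simp: cinner_def mult.commute)

lemma cinner_add_right:
  assumes "v \<in> carrier_vec n" "w \<in> carrier_vec n" "x \<in> carrier_vec n"
  shows "cinner v (w + x) = cinner v w + cinner v x"
  using assms by (auto simp: cinner_def distrib_left sum.distrib)

lemma cinner_diff_right:
  assumes "v \<in> carrier_vec n" "w \<in> carrier_vec n" "x \<in> carrier_vec n"
  shows "cinner v (w - x) = cinner v w - cinner v x"
  using assms by (auto simp: cinner_def right_diff_distrib sum_subtractf)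

lemma cinner_smult_right:
  assumes "v \<in> carrier_vec n" "w \<in> carrier_vec n"
  shows "cinner v (c \<cdot>\<^sub>v w) = c * cinner v w"
  using assms by (auto simp: cinner_def sum_distrib_left ac_simps intro!: sum.cong)

lemma cinner_self: "cinner v v = complex_of_real (\<Sum>i<dim_vec v. (cmod (v $ i))\<^sup>2)"
  unfolding cinner_def of_real_sum
  by (rule sum.cong) (simp_all only: complex_norm_square[symmetric] mult.commute[of "cnj _"])

lemma cinner_self_ge0: "Re (cinner v v) \<ge> 0"
  by (simp add: cinner_self sum_nonneg)

lemma cinner_self_real: "cinner v v = complex_of_real (Re (cinner v v))"
  by (simp add: cinner_self)

lemma cinner_self_eq0:
  assumes "v \<in> carrier_vec n" "Re (cinner v v) = 0"
  shows "v = 0\<^sub>v n"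
proof (rule eq_vecI)
  have "(\<Sum>i<n. (cmod (v $ i))\<^sup>2) = 0" using assms by (simp add: cinner_self)
  hence "\<forall>i\<in>{..<n}. (cmod (v $ i))\<^sup>2 = 0" by (subst (asm) sum_nonneg_eq_0_iff) auto
  thus "\<And>i. i < dim_vec (0\<^sub>v n) \<Longrightarrow> v $ i = 0\<^sub>v n $ i" by auto
qed (use assms in auto)

lemma trace_sum: "A \<in> carrier_mat n m \<Longrightarrow> trace A = (\<Sum>i<n. A $$ (i,i))"
  by (auto simp: trace_def)

lemma trace_mult:
  assumes "A \<in> carrier_mat n m" "B \<in> carrier_mat m n"
  shows "trace (A * B) = (\<Sum>i<n. \<Sum>j<m. A $$ (i,j) * B $$ (j,i))"
  using assms by (auto simp: trace_sum[of "A * B" n n] index_mult_mat_sum[OF assms] simp del: index_mult_mat(1))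

lemma trace_mult_commute:
  assumes "A \<in> carrier_mat n m" "B \<in> carrier_mat m n"
  shows "trace (A * B) = trace (B * A)"
  unfolding trace_mult[OF assms] trace_mult[OF assms(2,1)]
  by (subst sum.swap) (simp add: mult.commute)

lemma trace_add: "A \<in> carrier_mat n n \<Longrightarrow> B \<in> carrier_mat n n \<Longrightarrow> trace (A + B) = trace A + trace B"
  by (auto simp: trace_def sum.distrib)

lemma trace_minus: "A \<in> carrier_mat n n \<Longrightarrow> B \<in> carrier_mat n n \<Longrightarrow> trace (A - B) = trace A - trace B"
  by (auto simp: trace_def sum_subtractf)

lemma trace_smult: "trace (c \<cdot>\<^sub>m A) = c * trace A" if "A \<in> carrier_mat n n"
  using that by (auto simp: trace_def sum_distrib_left)

lemma trace_adj: "A \<in> carrier_mat n n \<Longrightarrow> trace (adj A) = cnj (trace A)"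
  by (auto simp: trace_def)

section \<open>Hermitian and positive semidefinite matrices\<close>

lemma hermitian_carrier: "hermitian n A \<Longrightarrow> A \<in> carrier_mat n n"
  by (simp add: hermitian_def)

lemma hermitian_minus: "hermitian n A \<Longrightarrow> hermitian n B \<Longrightarrow> hermitian n (A - B)"
  by (auto simp: hermitian_def adj_minus)

lemma hermitian_add: "hermitian n A \<Longrightarrow> hermitian n B \<Longrightarrow> hermitian n (A + B)"
  by (auto simp: hermitian_def adj_add)

lemma psd_hermitian: "psd n A \<Longrightarrow> hermitian n A"
  by (simp add: psd_def)

lemma psd_carrier: "psd n A \<Longrightarrow> A \<in> carrier_mat n n"
  by (simp add: psd_def hermitian_def)

lemma psd_add: "psd n A \<Longrightarrow> psd n B \<Longrightarrow> psd n (A + B)"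
  by (auto simp: psd_def hermitian_add cinner_add_right[of _ n] add_mult_distrib_mat_vec[of _ n n]
    dest!: hermitian_carrier)

lemma hermitian_congruence:
  assumes "hermitian n T" "C \<in> carrier_mat n p"
  shows "hermitian p (adj C * T * C)"
proof -
  have T: "T \<in> carrier_mat n n" "adj T = T" using assms(1) by (auto simp: hermitian_def)
  have "adj (adj C * T * C) = adj C * (T * C)"
    using T assms(2) adj_mult[of "adj C * T" p n C p] adj_mult[of "adj C" p n T n] by auto
  thus ?thesis using T assms(2) by (auto simp: hermitian_def)
qed

text \<open>The quadratic form of \<open>adj C * T * C\<close> at v is the form of T at
  \<open>C *\<^sub>v v\<close>.\<close>

lemma psd_congruence:
  assumes "psd n T" "C \<in> carrier_mat n p"
  shows "psd p (adj C * T * C)"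
  unfolding psd_def
proof (intro conjI ballI)
  have T: "T \<in> carrier_mat n n" using psd_carrier[OF assms(1)] .
  fix v :: "complex vec" assume v: "v \<in> carrier_vec p"
  have "(adj C * T * C) *\<^sub>v v = adj C *\<^sub>v (T *\<^sub>v (C *\<^sub>v v))"
    using T assms(2) v assoc_mult_mat_vec[of "adj C * T" p n C p v]
      assoc_mult_mat_vec[of "adj C" p n T n "C *\<^sub>v v"] by auto
  hence "cinner v ((adj C * T * C) *\<^sub>v v) = cinner (C *\<^sub>v v) (T *\<^sub>v (C *\<^sub>v v))"
    using T assms(2) v by (simp add: cinner_adj[of "adj C" p n])
  thus "0 \<le> Re (cinner v ((adj C * T * C) *\<^sub>v v))"
    using assms v by (auto simp: psd_def)
qed (rule hermitian_congruence[OF psd_hermitian[OF assms(1)] assms(2)])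

lemma psd_gram:
  assumes "C \<in> carrier_mat n p"
  shows "psd p (adj C * C)"
proof -
  have "psd n (1\<^sub>m n)" by (auto simp: psd_def hermitian_def cinner_self_ge0)
  from psd_congruence[OF this assms] show ?thesis using assms by simp
qed

text \<open>The side conditions mention dimensions only, so long products can be regrouped by
  rewriting without naming the sizes of the intermediate factors.\<close>

lemma mult_mat_assoc:
  fixes A B C :: "complex mat"
  assumes "dim_col A = dim_row B" "dim_col B = dim_row C"
  shows "A * B * C = A * (B * C)"
  by (rule assoc_mult_mat[of A "dim_row A" "dim_col A" B "dim_col B" C "dim_col C"])
    (simp_all only: carrier_mat_def mem_Collect_eq assms simp_thms)

lemma adj_mult_dim: "dim_col A = dim_row B \<Longrightarrow> adj (A * B) = adj B * adj A"
  by (rule adj_mult[of A "dim_row A" "dim_col A" B "dim_col B"])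
    (simp_all only: carrier_mat_def mem_Collect_eq simp_thms)

section \<open>Spectral theorem\<close>

definition unitary :: "nat \<Rightarrow> complex mat \<Rightarrow> bool" where
  "unitary n U \<longleftrightarrow> U \<in> carrier_mat n n \<and> adj U * U = 1\<^sub>m n \<and> U * adj U = 1\<^sub>m n"

definition real_diag :: "nat \<Rightarrow> (nat \<Rightarrow> real) \<Rightarrow> complex mat" where
  "real_diag n g = mat n n (\<lambda>(i,j). if i = j then complex_of_real (g i) else 0)"

text \<open>Functional calculus in coordinates: \<open>g\<close> gives one real eigenvalue per
  column of U. Operators sharing the same U commute, and identities between them reduce to
  identities between the functions \<open>g\<close>.\<close>

definition spec_mat :: "nat \<Rightarrow> complex mat \<Rightarrow> (nat \<Rightarrow> real) \<Rightarrow> complex mat" where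
  "spec_mat n U g = U * real_diag n g * adj U"

lemma unitaryI:
  assumes "U \<in> carrier_mat n n" "adj U * U = 1\<^sub>m n"
  shows "unitary n U"
  using mat_mult_left_right_inverse[OF _ assms(1,2)] assms by (auto simp: unitary_def)

lemma unitary_carrier: "unitary n U \<Longrightarrow> U \<in> carrier_mat n n"
  by (simp add: unitary_def)

lemma unitary_mult:
  assumes "unitary n U" "unitary n V"
  shows "unitary n (U * V)"
proof (rule unitaryI)
  have "adj (U * V) * (U * V) = adj V * (adj U * U) * V"
    using assms[THEN unitary_carrier] by (simp add: adj_mult_dim mult_mat_assoc del: assoc_mult_mat)
  thus "adj (U * V) * (U * V) = 1\<^sub>m n"
    using assms right_mult_one_mat[of "adj V" n n] by (simp add: unitary_def)
qed (use assms in \<open>auto simp: unitary_def\<close>)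

lemma real_diag_carrier[simp]: "real_diag n g \<in> carrier_mat n n"
  by (simp add: real_diag_def)

lemma real_diag_dim[simp]: "dim_row (real_diag n g) = n" "dim_col (real_diag n g) = n"
  by (simp_all add: real_diag_def)

lemma spec_mat_carrier[simp]: "U \<in> carrier_mat n n \<Longrightarrow> spec_mat n U g \<in> carrier_mat n n"
  by (auto simp: spec_mat_def)

lemma spec_mat_dim[simp]: "dim_row (spec_mat n U g) = dim_row U" "dim_col (spec_mat n U g) = dim_row U"
  by (simp_all add: spec_mat_def)

lemma index_mult_real_diag:
  assumes "U \<in> carrier_mat n n" "i < n" "j < n"
  shows "(U * real_diag n g) $$ (i,j) = complex_of_real (g j) * U $$ (i,j)"
proof -
  have "(U * real_diag n g) $$ (i,j) = (\<Sum>k<n. U $$ (i,k) * real_diag n g $$ (k,j))"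
    by (rule index_mult_mat_sum) (use assms in auto)
  also have "\<dots> = (\<Sum>k<n. if k = j then complex_of_real (g j) * U $$ (i,j) else 0)"
    by (rule sum.cong) (use assms in \<open>auto simp: real_diag_def\<close>)
  finally show ?thesis using assms by simp
qed

lemma index_spec_mat:
  assumes "U \<in> carrier_mat n n" "i < n" "j < n"
  shows "spec_mat n U g $$ (i,j) = (\<Sum>k<n. complex_of_real (g k) * U $$ (i,k) * cnj (U $$ (j,k)))"
proof -
  have "spec_mat n U g $$ (i,j) = (\<Sum>k<n. (U * real_diag n g) $$ (i,k) * adj U $$ (k,j))"
    unfolding spec_mat_def by (rule index_mult_mat_sum) (use assms in auto)
  also have "\<dots> = (\<Sum>k<n. complex_of_real (g k) * U $$ (i,k) * cnj (U $$ (j,k)))"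
    by (rule sum.cong) (use assms in \<open>auto simp: index_mult_real_diag simp del: index_mult_mat(1)\<close>)
  finally show ?thesis .
qed

text \<open>Complete v to a basis and orthogonalise. Gram-Schmidt keeps the first vector, so
  normalisation is all that happens to v; this is the scalar \<open>c\<close>.\<close>

lemma unitary_with_first_col:
  fixes v :: "complex vec"
  assumes v: "v \<in> carrier_vec n" "v \<noteq> 0\<^sub>v n" and n: "0 < n"
  obtains W c where "unitary n W" "col W 0 = c \<cdot>\<^sub>v v"
proof -
  interpret cof_vec_space n "TYPE(complex)" .
  define ws where "ws = gram_schmidt n (basis_completion v)"
  note bc = basis_completion[OF v]
  have orth: "corthogonal ws" and car: "set ws \<subseteq> carrier_vec n" and len: "length ws = n"
    using gram_schmidt_result[OF bc(2,4,5) ws_def] bc(6) by auto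
  have "basis_completion v \<noteq> []" using bc(6) n by auto
  then obtain us where us: "basis_completion v = v # us" using bc(7) by (cases "basis_completion v") auto
  have hd: "hd ws = v" unfolding ws_def us using v by simp
  \<comment> \<open>Gram-Schmidt yields orthogonal vectors that need not be unit vectors;
    \<open>s i\<close> is the norm of the i-th one and is divided out in W.\<close>
  define s where "s i = complex_of_real (sqrt (Re (cinner (ws ! i) (ws ! i))))" for i
  have cv: "ws ! i \<in> carrier_vec n" if "i < n" for i using car len that by auto
  have inn: "ws ! j \<bullet>c ws ! i = cinner (ws ! i) (ws ! j)" if "i < n" "j < n" for i j
    using cv that by (auto simp: scalar_prod_def cinner_def lessThan_atLeast0 mult.commute intro!: sum.cong)
  have eq0: "cinner (ws ! i) (ws ! j) = 0 \<longleftrightarrow> i \<noteq> j" if "i < n" "j < n" for i j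
    using corthogonalD[OF orth, of j i] inn[OF that] that len by auto
  have ss: "s i * s i = cinner (ws ! i) (ws ! i)" for i
  proof -
    have "s i * s i = complex_of_real (Re (cinner (ws ! i) (ws ! i)))"
      unfolding s_def of_real_mult[symmetric] using cinner_self_ge0[of "ws ! i"] by simp
    thus ?thesis using cinner_self_real[of "ws ! i"] by simp
  qed
  have s0: "s i \<noteq> 0" if "i < n" for i using ss[of i] eq0[OF that that] by auto
  define W where "W = mat n n (\<lambda>(i,j). ws ! j $ i / s j)"
  have W: "W \<in> carrier_mat n n" by (simp add: W_def)
  have "adj W * W = 1\<^sub>m n"
  proof (rule eq_matI)
    fix i j assume "i < dim_row (1\<^sub>m n)" "j < dim_col (1\<^sub>m n)"
    hence ij: "i < n" "j < n" by auto
    have "(adj W * W) $$ (i,j) = (\<Sum>k<n. adj W $$ (i,k) * W $$ (k,j))"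
      by (rule index_mult_mat_sum) (use W ij in auto)
    also have "\<dots> = (\<Sum>k<n. cnj (ws ! i $ k) * ws ! j $ k / (s i * s j))"
      by (rule sum.cong) (use ij in \<open>auto simp: W_def s_def\<close>)
    also have "\<dots> = cinner (ws ! i) (ws ! j) / (s i * s j)"
      unfolding cinner_sum[OF cv[OF ij(1)]] by (simp add: sum_divide_distrib)
    also have "\<dots> = 1\<^sub>m n $$ (i,j)"
      using ij eq0[OF ij] s0[OF ij(1)] ss[of i] by auto
    finally show "(adj W * W) $$ (i,j) = 1\<^sub>m n $$ (i,j)" .
  qed (use W in auto)
  hence "unitary n W" by (rule unitaryI[OF W])
  moreover have "col W 0 = (1 / s 0) \<cdot>\<^sub>v v"
  proof (rule eq_vecI)
    have "ws ! 0 = v" using hd len n hd_conv_nth[of ws] by fastforce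
    thus "\<And>i. i < dim_vec ((1 / s 0) \<cdot>\<^sub>v v) \<Longrightarrow> col W 0 $ i = ((1 / s 0) \<cdot>\<^sub>v v) $ i"
      using v n by (auto simp: W_def)
  qed (use v W in auto)
  ultimately show thesis by (rule that)
qed

lemma spec_mat_conj:
  assumes "W \<in> carrier_mat n n" "V \<in> carrier_mat n n"
  shows "W * spec_mat n V g * adj W = spec_mat n (W * V) g"
  using assms by (simp add: spec_mat_def adj_mult_dim mult_mat_assoc del: assoc_mult_mat)

text \<open>Deflation: conjugating with a unitary whose first column is an eigenvector clears the
  first column below the corner, and Hermitian symmetry then clears the first row as well. The
  remaining block is Hermitian of size n, so the induction hypothesis applies to it.\<close>

theorem hermitian_spectral:
  assumes "hermitian n A"
  shows "\<exists>U e. unitary n U \<and> A = spec_mat n U e"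
  using assms
proof (induction n arbitrary: A)
  case 0
  have "unitary 0 (1\<^sub>m 0)" by (auto simp: unitary_def)
  moreover have "A = spec_mat 0 (1\<^sub>m 0) (\<lambda>_. 0)"
    using 0 by (intro eq_matI) (auto simp: hermitian_def spec_mat_def)
  ultimately show ?case by blast
next
  case (Suc n)
  have A: "A \<in> carrier_mat (Suc n) (Suc n)" using Suc.prems by (rule hermitian_carrier)
  obtain e where "e \<in> spectrum A" using spectrum_non_empty[OF A] by auto
  then obtain v where v: "v \<in> carrier_vec (Suc n)" "v \<noteq> 0\<^sub>v (Suc n)" and ev: "A *\<^sub>v v = e \<cdot>\<^sub>v v"
    using A by (auto simp: spectrum_def eigenvalue_def eigenvector_def)
  obtain W c where W: "unitary (Suc n) W" and W0: "col W 0 = c \<cdot>\<^sub>v v"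
    using unitary_with_first_col[OF v] by blast
  have Wc: "W \<in> carrier_mat (Suc n) (Suc n)" using W by (rule unitary_carrier)
  define A' where "A' = adj W * A * W"
  have hA': "hermitian (Suc n) A'" unfolding A'_def by (rule hermitian_congruence[OF Suc.prems Wc])
  have A': "A' \<in> carrier_mat (Suc n) (Suc n)" using hA' by (rule hermitian_carrier)
  have sym: "A' $$ (i,j) = cnj (A' $$ (j,i))" if "i < Suc n" "j < Suc n" for i j
    using hA' that index_adj[of i A' j] by (auto simp: hermitian_def)
  have "A *\<^sub>v col W 0 = e \<cdot>\<^sub>v col W 0"
    unfolding W0 using mult_mat_vec[OF A v(1), of c] ev by (simp add: smult_smult_assoc mult.commute)
  have c0: "col A' 0 = e \<cdot>\<^sub>v col (1\<^sub>m (Suc n)) 0"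
  proof -
    have "col A' 0 = adj W *\<^sub>v (A *\<^sub>v col W 0)"
      unfolding A'_def using A Wc
      by (intro eq_vecI) (auto simp: mult_mat_assoc mult_mat_vec_def simp del: assoc_mult_mat)
    also have "\<dots> = e \<cdot>\<^sub>v (adj W *\<^sub>v col W 0)"
      unfolding \<open>A *\<^sub>v col W 0 = e \<cdot>\<^sub>v col W 0\<close>
      by (rule mult_mat_vec[of _ "Suc n" "Suc n"]) (use Wc col_dim[of W 0] in auto)
    also have "adj W *\<^sub>v col W 0 = col (adj W * W) 0" using Wc by (simp add: mult_mat_vec_def)
    finally show ?thesis using W by (simp add: unitary_def)
  qed
  have A'i0: "A' $$ (i,0) = (if i = 0 then e else 0)" if "i < Suc n" for i
  proof -
    have "A' $$ (i,0) = col A' 0 $ i" using A' that by simp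
    thus ?thesis unfolding c0 using that by simp
  qed
  \<comment> \<open>The corner entry of a Hermitian matrix is its own conjugate, so the eigenvalue,
    found over the complex numbers, is real.\<close>
  have ereal: "e = complex_of_real (Re e)"
    using sym[of 0 0] A'i0[of 0] by (simp add: complex_eq_iff)
  have A'0i: "A' $$ (0,i) = (if i = 0 then e else 0)" if "i < Suc n" for i
    using sym[of 0 i] A'i0[of i] that ereal by (auto simp: complex_eq_iff)
  define A3 where "A3 = mat n n (\<lambda>(i,j). A' $$ (Suc i, Suc j))"
  have "adj A3 = A3" unfolding A3_def by (intro eq_matI) (auto intro: sym[symmetric])
  hence "hermitian n A3" by (auto simp: hermitian_def A3_def)
  then obtain U3 e3 where U3: "unitary n U3" and e3: "A3 = spec_mat n U3 e3" using Suc.IH by blast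
  have U3c: "U3 \<in> carrier_mat n n" using U3 by (rule unitary_carrier)
  \<comment> \<open>The block sum of the 1 by 1 identity and \<open>U3\<close>: it diagonalises the
    lower block and leaves the corner alone.\<close>
  define V where "V = mat (Suc n) (Suc n)
    (\<lambda>(i,j). if i = 0 \<or> j = 0 then (if i = j then 1 else 0) else U3 $$ (i - 1, j - 1))"
  have V: "V \<in> carrier_mat (Suc n) (Suc n)" by (simp add: V_def)
  have "adj V * V = 1\<^sub>m (Suc n)"
  proof (rule eq_matI)
    fix i j assume "i < dim_row (1\<^sub>m (Suc n))" "j < dim_col (1\<^sub>m (Suc n))"
    hence ij: "i < Suc n" "j < Suc n" by auto
    have "(adj V * V) $$ (i,j) = (\<Sum>k<Suc n. adj V $$ (i,k) * V $$ (k,j))"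
      by (rule index_mult_mat_sum) (use V ij in auto)
    also have "\<dots> = (\<Sum>k<Suc n. cnj (V $$ (k,i)) * V $$ (k,j))"
      by (rule sum.cong) (use V ij in auto)
    also have "\<dots> = 1\<^sub>m (Suc n) $$ (i,j)"
    proof (cases "i = 0 \<or> j = 0")
      case True
      thus ?thesis unfolding sum.lessThan_Suc_shift using ij by (auto simp: V_def)
    next
      case False
      then obtain a b where ab: "i = Suc a" "j = Suc b" by (cases i; cases j) auto
      have "(\<Sum>k<Suc n. cnj (V $$ (k,i)) * V $$ (k,j)) = (\<Sum>k<n. cnj (U3 $$ (k,a)) * U3 $$ (k,b))"
        unfolding sum.lessThan_Suc_shift using ij ab by (auto simp: V_def)
      also have "\<dots> = (\<Sum>k<n. adj U3 $$ (a,k) * U3 $$ (k,b))"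
        by (rule sum.cong) (use U3c ij ab in auto)
      also have "\<dots> = (adj U3 * U3) $$ (a,b)"
        by (rule index_mult_mat_sum[symmetric, of _ n n _ n]) (use U3c ij ab in auto)
      also have "\<dots> = 1\<^sub>m (Suc n) $$ (i,j)" using U3 ij ab by (simp add: unitary_def)
      finally show ?thesis .
    qed
    finally show "(adj V * V) $$ (i,j) = 1\<^sub>m (Suc n) $$ (i,j)" .
  qed (use V in auto)
  hence uV: "unitary (Suc n) V" by (rule unitaryI[OF V])
  \<comment> \<open>The deflated eigenvalue is put in front of those of the block, matching the
    index shift in V.\<close>
  define g where "g = case_nat (Re e) e3"
  have "A' = spec_mat (Suc n) V g"
  proof (rule eq_matI)
    fix i j assume "i < dim_row (spec_mat (Suc n) V g)" "j < dim_col (spec_mat (Suc n) V g)"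
    hence ij: "i < Suc n" "j < Suc n" using spec_mat_carrier[OF V, of g] by auto
    show "A' $$ (i,j) = spec_mat (Suc n) V g $$ (i,j)"
    proof (cases "i = 0 \<or> j = 0")
      case True
      thus ?thesis
        unfolding index_spec_mat[OF V ij] sum.lessThan_Suc_shift
        using ij A'i0 A'0i ereal by (auto simp: V_def g_def)
    next
      case False
      then obtain a b where ab: "i = Suc a" "j = Suc b" by (cases i; cases j) auto
      have "spec_mat (Suc n) V g $$ (i,j) = spec_mat n U3 e3 $$ (a,b)"
        using ij ab unfolding index_spec_mat[OF V ij] sum.lessThan_Suc_shift
        by (subst index_spec_mat[OF U3c]) (auto simp: V_def g_def)
      also have "\<dots> = A' $$ (i,j)" unfolding e3[symmetric] using ij ab by (simp add: A3_def)
      finally show ?thesis by simp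
    qed
  qed (use A' spec_mat_carrier[OF V, of g] in auto)
  moreover have "A = W * A' * adj W"
  proof -
    have "W * A' * adj W = (W * adj W) * A * (W * adj W)"
      unfolding A'_def using A Wc by (simp add: mult_mat_assoc del: assoc_mult_mat)
    thus ?thesis using W A by (simp add: unitary_def)
  qed
  ultimately have "A = spec_mat (Suc n) (W * V) g" by (simp add: spec_mat_conj[OF Wc V])
  thus ?case using unitary_mult[OF W uV] by blast
qed

section \<open>Functional calculus and trace norm\<close>

lemma spec_mat_hermitian:
  assumes "U \<in> carrier_mat n n"
  shows "hermitian n (spec_mat n U g)"
proof -
  have "hermitian n (real_diag n g)" by (auto simp: hermitian_def real_diag_def intro!: eq_matI)
  from hermitian_congruence[OF this, of "adj U" n] show ?thesis
    using assms by (simp add: spec_mat_def)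
qed

lemma spec_mat_cong:
  assumes "\<And>i. i < n \<Longrightarrow> g i = h i"
  shows "spec_mat n U g = spec_mat n U h"
proof -
  have "real_diag n g = real_diag n h" using assms by (auto simp: real_diag_def)
  thus ?thesis by (simp add: spec_mat_def)
qed

lemma spec_mat_mult:
  assumes "unitary n U"
  shows "spec_mat n U g * spec_mat n U h = spec_mat n U (\<lambda>i. g i * h i)"
proof -
  have U: "U \<in> carrier_mat n n" using assms by (rule unitary_carrier)
  have "real_diag n g * real_diag n h = real_diag n (\<lambda>i. g i * h i)"
    by (rule eq_matI) (auto simp: index_mult_real_diag real_diag_def[of n g] real_diag_def[of n "\<lambda>i. g i * h i"]
       simp del: index_mult_mat(1))
  moreover have "spec_mat n U g * spec_mat n U h
      = U * real_diag n g * (adj U * U) * real_diag n h * adj U"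
    using U by (simp add: spec_mat_def mult_mat_assoc del: assoc_mult_mat)
  moreover have "\<dots> = U * (real_diag n g * real_diag n h) * adj U"
    using assms U by (simp add: unitary_def mult_mat_assoc del: assoc_mult_mat)
  ultimately show ?thesis by (simp add: spec_mat_def)
qed

lemma spec_mat_add:
  assumes "U \<in> carrier_mat n n"
  shows "spec_mat n U g + spec_mat n U h = spec_mat n U (\<lambda>i. g i + h i)"
  using spec_mat_carrier[OF assms, of g] spec_mat_carrier[OF assms, of h]
    spec_mat_carrier[OF assms, of "\<lambda>i. g i + h i"]
  by (intro eq_matI) (auto simp: index_spec_mat[OF assms] sum.distrib distrib_right)

lemma spec_mat_minus:
  assumes "U \<in> carrier_mat n n"
  shows "spec_mat n U g - spec_mat n U h = spec_mat n U (\<lambda>i. g i - h i)"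
  using spec_mat_carrier[OF assms, of g] spec_mat_carrier[OF assms, of h]
    spec_mat_carrier[OF assms, of "\<lambda>i. g i - h i"]
  by (intro eq_matI) (auto simp: index_spec_mat[OF assms] sum_subtractf left_diff_distrib)

lemma spec_mat_one:
  assumes "unitary n U"
  shows "spec_mat n U (\<lambda>_. 1) = 1\<^sub>m n"
proof -
  have "real_diag n (\<lambda>_. 1) = 1\<^sub>m n" by (auto simp: real_diag_def one_mat_def)
  thus ?thesis using assms by (auto simp: spec_mat_def unitary_def)
qed

text \<open>Only the diagonal of T in the basis of columns of U enters. This turns estimates of
  traces over all effects into estimates for each index k separately.\<close>

lemma trace_mult_spec_mat:
  assumes U: "U \<in> carrier_mat n n" and T: "T \<in> carrier_mat n n"
  shows "trace (T * spec_mat n U g) = (\<Sum>k<n. complex_of_real (g k) * cinner (col U k) (T *\<^sub>v col U k))"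
proof -
  have "trace (T * spec_mat n U g)
      = (\<Sum>i<n. \<Sum>j<n. \<Sum>k<n. complex_of_real (g k) * (cnj (U $$ (i,k)) * T $$ (i,j) * U $$ (j,k)))"
    unfolding trace_mult[OF T spec_mat_carrier[OF U]]
    by (auto intro!: sum.cong simp: index_spec_mat[OF U] sum_distrib_left ac_simps)
  also have "\<dots> = (\<Sum>i<n. \<Sum>k<n. \<Sum>j<n. complex_of_real (g k) * (cnj (U $$ (i,k)) * T $$ (i,j) * U $$ (j,k)))"
    by (rule sum.cong[OF refl], rule sum.swap)
  also have "\<dots> = (\<Sum>k<n. \<Sum>i<n. \<Sum>j<n. complex_of_real (g k) * (cnj (U $$ (i,k)) * T $$ (i,j) * U $$ (j,k)))"
    by (rule sum.swap)
  also have "\<dots> = (\<Sum>k<n. complex_of_real (g k) * cinner (col U k) (T *\<^sub>v col U k))"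
  proof (rule sum.cong[OF refl])
    fix k assume "k \<in> {..<n}"
    hence "k < n" by simp
    have c: "col U k \<in> carrier_vec n" using U col_dim[of U k] by auto
    show "(\<Sum>i<n. \<Sum>j<n. complex_of_real (g k) * (cnj (U $$ (i,k)) * T $$ (i,j) * U $$ (j,k)))
        = complex_of_real (g k) * cinner (col U k) (T *\<^sub>v col U k)"
      unfolding cinner_mult_vec[OF T c c] using U \<open>k < n\<close> by (auto simp: sum_distrib_left)
  qed
  finally show ?thesis .
qed

lemma col_carrier: "U \<in> carrier_mat n m \<Longrightarrow> col U k \<in> carrier_vec n"
  using col_dim[of U k] by auto

lemma cinner_col:
  assumes "unitary n U" "i < n" "j < n"
  shows "cinner (col U i) (col U j) = (if i = j then 1 else 0)"
proof -
  have U: "U \<in> carrier_mat n n" using assms(1) by (rule unitary_carrier)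
  have "(adj U * U) $$ (i,j) = (\<Sum>k<n. adj U $$ (i,k) * U $$ (k,j))"
    by (rule index_mult_mat_sum) (use U assms in auto)
  also have "\<dots> = cinner (col U i) (col U j)"
    unfolding cinner_sum[OF col_carrier[OF U]] using U assms by (auto intro!: sum.cong)
  finally show ?thesis using assms by (simp add: unitary_def)
qed

lemma trace_spec_mat:
  assumes "unitary n U"
  shows "trace (spec_mat n U g) = complex_of_real (\<Sum>k<n. g k)"
proof -
  have U: "U \<in> carrier_mat n n" using assms by (rule unitary_carrier)
  have "trace (spec_mat n U g) = trace (1\<^sub>m n * spec_mat n U g)" using U by simp
  also have "\<dots> = (\<Sum>k<n. complex_of_real (g k))"
    unfolding trace_mult_spec_mat[OF U one_carrier_mat]
    by (rule sum.cong) (use col_carrier[OF U] in \<open>auto simp: cinner_col[OF assms]\<close>)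
  finally show ?thesis by simp
qed

lemma spec_mat_col:
  assumes "unitary n U" "k < n"
  shows "spec_mat n U g *\<^sub>v col U k = complex_of_real (g k) \<cdot>\<^sub>v col U k"
proof -
  have U: "U \<in> carrier_mat n n" using assms(1) by (rule unitary_carrier)
  have "spec_mat n U g * U = U * real_diag n g * (adj U * U)"
    using U by (simp add: spec_mat_def mult_mat_assoc del: assoc_mult_mat)
  hence *: "spec_mat n U g * U = U * real_diag n g" using assms U by (auto simp: unitary_def)
  have "spec_mat n U g *\<^sub>v col U k = col (spec_mat n U g * U) k"
    using U assms(2) by (intro eq_vecI) auto
  also have "\<dots> = complex_of_real (g k) \<cdot>\<^sub>v col U k"
    unfolding * using U assms(2)
    by (intro eq_vecI) (auto simp: index_mult_real_diag col_def simp del: index_mult_mat(1))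
  finally show ?thesis .
qed

text \<open>Taking square roots of the eigenvalues exhibits the operator as a Gram matrix.\<close>

lemma spec_mat_psd:
  assumes "unitary n U" "\<And>k. k < n \<Longrightarrow> g k \<ge> 0"
  shows "psd n (spec_mat n U g)"
proof -
  have U: "U \<in> carrier_mat n n" using assms(1) by (rule unitary_carrier)
  let ?S = "spec_mat n U (\<lambda>k. sqrt (g k))"
  have "adj ?S * ?S = spec_mat n U (\<lambda>k. sqrt (g k) * sqrt (g k))"
    using spec_mat_hermitian[OF U] spec_mat_mult[OF assms(1)] by (simp add: hermitian_def)
  also have "\<dots> = spec_mat n U g" by (rule spec_mat_cong) (simp add: assms(2))
  finally show ?thesis using psd_gram[of ?S n n] U by simp
qed

lemma psd_spec_mat_nonneg:
  assumes "unitary n U" "psd n (spec_mat n U g)" "k < n"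
  shows "g k \<ge> 0"
proof -
  have U: "U \<in> carrier_mat n n" using assms(1) by (rule unitary_carrier)
  have "0 \<le> Re (cinner (col U k) (spec_mat n U g *\<^sub>v col U k))"
    using assms(2) col_carrier[OF U] by (simp add: psd_def)
  also have "cinner (col U k) (spec_mat n U g *\<^sub>v col U k) = complex_of_real (g k)"
    by (simp add: spec_mat_col[OF assms(1,3)] cinner_smult_right[OF col_carrier[OF U] col_carrier[OF U]]
      cinner_col[OF assms(1,3,3)])
  finally show ?thesis by simp
qed

section \<open>Square roots and the trace norm\<close>

lemma psd_sqrt_exists:
  assumes "psd n T"
  shows "\<exists>S. psd n S \<and> S * S = T"
proof -
  obtain U e where U: "unitary n U" and T: "T = spec_mat n U e"
    using hermitian_spectral[OF psd_hermitian[OF assms]] by blast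
  have e: "e k \<ge> 0" if "k < n" for k using psd_spec_mat_nonneg[OF U _ that] assms T by simp
  let ?S = "spec_mat n U (\<lambda>k. sqrt (e k))"
  have "psd n ?S" by (rule spec_mat_psd[OF U]) (simp add: e)
  moreover have "?S * ?S = T"
    unfolding spec_mat_mult[OF U] T by (rule spec_mat_cong) (simp add: e)
  ultimately show ?thesis by blast
qed

text \<open>Let v be a unit eigenvector of \<open>S - T\<close> with eigenvalue e. Expanding both
  squares gives \<open><v, S S v> - <v, T T v> = e (<v, S v> + <v, T v>)\<close>, so e times a sum
  of two nonnegative numbers vanishes. Every eigenvalue of \<open>S - T\<close> turns out to be
  zero, and S and T need not be assumed to commute.\<close>

lemma psd_sqrt_unique:
  assumes S: "psd n S" and T: "psd n T" and eq: "S * S = T * T"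
  shows "S = T"
proof -
  have Sc: "S \<in> carrier_mat n n" and Tc: "T \<in> carrier_mat n n" using S T by (auto intro: psd_carrier)
  have h: "hermitian n (S - T)" using S T by (intro hermitian_minus psd_hermitian)
  obtain U e where U: "unitary n U" and W: "S - T = spec_mat n U e" using hermitian_spectral[OF h] by blast
  have Uc: "U \<in> carrier_mat n n" using U by (rule unitary_carrier)
  have e0: "e k = 0" if k: "k < n" for k
  proof -
    let ?v = "col U k"
    have v: "?v \<in> carrier_vec n" using col_carrier[OF Uc] .
    let ?s = "cinner ?v (S *\<^sub>v ?v)" and ?t = "cinner ?v (T *\<^sub>v ?v)"
    have Wv: "S *\<^sub>v ?v - T *\<^sub>v ?v = complex_of_real (e k) \<cdot>\<^sub>v ?v"
      using spec_mat_col[OF U k, of e] minus_mult_distrib_mat_vec[OF Sc Tc v] by (simp add: W)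
    have Svv: "S *\<^sub>v ?v \<in> carrier_vec n" and Tvv: "T *\<^sub>v ?v \<in> carrier_vec n" using Sc Tc v by auto
    have inn: "?s - ?t = complex_of_real (e k)"
      using cinner_diff_right[OF v Svv Tvv] Wv cinner_smult_right[OF v v] cinner_col[OF U k k] by simp
    have Sv: "S *\<^sub>v ?v = T *\<^sub>v ?v + complex_of_real (e k) \<cdot>\<^sub>v ?v"
    proof (rule eq_vecI)
      fix i assume "i < dim_vec (T *\<^sub>v ?v + complex_of_real (e k) \<cdot>\<^sub>v ?v)"
      hence i: "i < n" using Uc by simp
      have "(S *\<^sub>v ?v - T *\<^sub>v ?v) $ i = (complex_of_real (e k) \<cdot>\<^sub>v ?v) $ i" by (simp only: Wv)
      thus "(S *\<^sub>v ?v) $ i = (T *\<^sub>v ?v + complex_of_real (e k) \<cdot>\<^sub>v ?v) $ i"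
        using i Svv Tvv v Sc Tc Uc by (simp add: algebra_simps del: index_mult_mat_vec)
    qed (use Sc Uc in auto)
    have 1: "cinner ?v (S *\<^sub>v (S *\<^sub>v ?v)) = cinner ?v (T *\<^sub>v (T *\<^sub>v ?v))"
      using eq assoc_mult_mat_vec[OF Sc Sc v] assoc_mult_mat_vec[OF Tc Tc v] by simp
    have 2: "cinner ?v (S *\<^sub>v (S *\<^sub>v ?v)) = cinner ?v (S *\<^sub>v (T *\<^sub>v ?v)) + complex_of_real (e k) * ?s"
    proof -
      have "S *\<^sub>v (S *\<^sub>v ?v) = S *\<^sub>v (T *\<^sub>v ?v) + complex_of_real (e k) \<cdot>\<^sub>v (S *\<^sub>v ?v)"
        unfolding Sv using Tvv v
        by (simp add: mult_add_distrib_mat_vec[OF Sc Tvv] mult_mat_vec[OF Sc v] Sv)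
      thus ?thesis using Sc Tvv Svv v
        by (simp add: cinner_add_right[of _ n] cinner_smult_right[of _ n])
    qed
    have "adj S = S" "adj T = T" using S T by (auto simp: psd_def hermitian_def)
    hence 3: "cinner ?v (S *\<^sub>v (T *\<^sub>v ?v)) = cinner (S *\<^sub>v ?v) (T *\<^sub>v ?v)"
      and 4: "cinner ?v (T *\<^sub>v (T *\<^sub>v ?v)) = cinner (T *\<^sub>v ?v) (T *\<^sub>v ?v)"
      using cinner_adj[OF Sc v Tvv] cinner_adj[OF Tc v Tvv] by auto
    have 5: "cinner (S *\<^sub>v ?v) (T *\<^sub>v ?v) = cinner (T *\<^sub>v ?v) (T *\<^sub>v ?v) + complex_of_real (e k) * ?t"
    proof -
      have "cinner (T *\<^sub>v ?v) (S *\<^sub>v ?v)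
          = cinner (T *\<^sub>v ?v) (T *\<^sub>v ?v) + complex_of_real (e k) * cinner (T *\<^sub>v ?v) ?v"
        unfolding Sv using Tvv v by (simp add: cinner_add_right[of _ n] cinner_smult_right[of _ n])
      from arg_cong[OF this, of cnj] show ?thesis
        using cinner_commute[OF Tvv Svv] cinner_commute[OF Tvv v] cinner_commute[OF Tvv Tvv] by simp
    qed
    \<comment> \<open>If \<open>e k\<close> were nonzero, both forms would have to vanish, and so
      would their difference, which is \<open>e k\<close> itself.\<close>
    have "complex_of_real (e k) * (?s + ?t) = 0" using 1 2 3 4 5 by (simp add: algebra_simps)
    hence "e k = 0 \<or> Re (?s + ?t) = 0" by (metis mult_eq_0_iff of_real_eq_0_iff zero_complex.sel(1))
    moreover have "Re ?s \<ge> 0" "Re ?t \<ge> 0" using S T v by (auto simp: psd_def)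
    moreover have "Re ?s - Re ?t = e k" using arg_cong[OF inn, of Re] by simp
    ultimately show "e k = 0" by auto
  qed
  have W0: "S - T = spec_mat n U (\<lambda>_. 0)" unfolding W by (rule spec_mat_cong) (rule e0)
  show "S = T"
  proof (rule eq_matI)
    fix i j assume ij: "i < dim_row T" "j < dim_col T"
    have "(S - T) $$ (i,j) = 0" unfolding W0 using ij Tc by (simp add: index_spec_mat[OF Uc])
    thus "S $$ (i,j) = T $$ (i,j)" using ij by simp
  qed (use Sc Tc in auto)
qed

text \<open>The absolute values of the eigenvalues give a psd square root of
  \<open>adj X * X\<close>; uniqueness identifies it with the one described in the
  definition.\<close>

lemma trace_norm_spec_mat:
  assumes U: "unitary n U"
  shows "trace_norm n (spec_mat n U e) = (\<Sum>k<n. \<bar>e k\<bar>)"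
proof -
  have Uc: "U \<in> carrier_mat n n" using U by (rule unitary_carrier)
  let ?S = "spec_mat n U (\<lambda>k. \<bar>e k\<bar>)"
  have S: "psd n ?S" by (rule spec_mat_psd[OF U]) simp
  have SS: "?S * ?S = adj (spec_mat n U e) * spec_mat n U e"
    using spec_mat_hermitian[OF Uc, of e] by (simp add: hermitian_def spec_mat_mult[OF U])
  have "(THE S. psd n S \<and> S * S = adj (spec_mat n U e) * spec_mat n U e) = ?S"
  proof (rule the_equality)
    fix T assume "psd n T \<and> T * T = adj (spec_mat n U e) * spec_mat n U e"
    thus "T = ?S" using SS psd_sqrt_unique[OF _ S] by simp
  qed (use S SS in simp)
  thus ?thesis by (simp add: trace_norm_def trace_spec_mat[OF U])
qed

text \<open>With \<open>T = S * S\<close> the form at v is the squared norm of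
  \<open>S *\<^sub>v v\<close>. The lemma upgrades information about one diagonal entry to
  information about a whole vector.\<close>

lemma psd_kernel:
  assumes T: "psd n T" and v: "v \<in> carrier_vec n" and 0: "Re (cinner v (T *\<^sub>v v)) = 0"
  shows "T *\<^sub>v v = 0\<^sub>v n"
proof -
  obtain S where S: "psd n S" and SS: "S * S = T" using psd_sqrt_exists[OF T] by blast
  have Sc: "S \<in> carrier_mat n n" and "adj S = S" using S by (auto simp: psd_def hermitian_def)
  have Sv: "S *\<^sub>v v \<in> carrier_vec n" using Sc v by simp
  have Tv: "T *\<^sub>v v = S *\<^sub>v (S *\<^sub>v v)" unfolding SS[symmetric] by (rule assoc_mult_mat_vec[OF Sc Sc v])
  have "Re (cinner (S *\<^sub>v v) (S *\<^sub>v v)) = 0"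
    using 0 cinner_adj[OF Sc v Sv] \<open>adj S = S\<close> by (simp add: Tv)
  hence "S *\<^sub>v v = 0\<^sub>v n" by (rule cinner_self_eq0[OF Sv])
  thus ?thesis using Tv Sc by (intro eq_vecI) auto
qed

text \<open>In an eigenbasis of T the trace is a sum of products of an eigenvalue of T with a value
  of the form of S, all nonnegative. The product \<open>S * T\<close> itself is in general not
  Hermitian.\<close>

lemma trace_mult_psd_nonneg:
  assumes "psd n S" "psd n T"
  shows "Re (trace (S * T)) \<ge> 0"
proof -
  obtain U e where U: "unitary n U" and T: "T = spec_mat n U e"
    using hermitian_spectral[OF psd_hermitian[OF assms(2)]] by blast
  have Uc: "U \<in> carrier_mat n n" using U by (rule unitary_carrier)
  have "e k \<ge> 0" if "k < n" for k using psd_spec_mat_nonneg[OF U _ that] assms(2) T by simp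
  moreover have "Re (cinner (col U k) (S *\<^sub>v col U k)) \<ge> 0" for k
    using assms(1) col_carrier[OF Uc] by (simp add: psd_def)
  ultimately show ?thesis
    unfolding T trace_mult_spec_mat[OF Uc psd_carrier[OF assms(1)]]
    by (auto intro!: sum_nonneg)
qed

section \<open>Spectral projectors\<close>

lemma eq_mat_by_vec:
  fixes A B :: "complex mat"
  assumes "A \<in> carrier_mat n m" "B \<in> carrier_mat n m"
    and "\<And>v. v \<in> carrier_vec m \<Longrightarrow> A *\<^sub>v v = B *\<^sub>v v"
  shows "A = B"
proof (rule eq_matI)
  fix i j assume ij: "i < dim_row B" "j < dim_col B"
  have "(A *\<^sub>v unit_vec m j) $ i = (B *\<^sub>v unit_vec m j) $ i" using assms(3)[of "unit_vec m j"] by simp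
  thus "A $$ (i,j) = B $$ (i,j)" using ij assms(1,2) by simp
qed (use assms in auto)

text \<open>A projector fixes its range pointwise, so two projectors P and Q with equal ranges
  satisfy \<open>P * Q = Q\<close> and \<open>Q * P = P\<close>. Taking adjoints in the second
  equation gives \<open>P * Q = P\<close>, hence \<open>Q = P\<close>.\<close>

lemma orth_proj_eqI:
  assumes P: "hermitian n P" "P * P = P" and W: "{P *\<^sub>v v | v. v \<in> carrier_vec n} = W"
  shows "orth_proj n W = P"
  unfolding orth_proj_def
proof (rule the_equality)
  have absorb: "R * Q = Q"
    if R: "hermitian n R" "R * R = R" "{R *\<^sub>v v | v. v \<in> carrier_vec n} = W"
      and Q: "hermitian n Q" "{Q *\<^sub>v v | v. v \<in> carrier_vec n} = W" for Q R
  proof (rule eq_mat_by_vec)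
    have Rc: "R \<in> carrier_mat n n" and Qc: "Q \<in> carrier_mat n n" using R Q by (auto intro: hermitian_carrier)
    thus "R * Q \<in> carrier_mat n n" "Q \<in> carrier_mat n n" by auto
    fix v :: "complex vec" assume v: "v \<in> carrier_vec n"
    then obtain w where w: "w \<in> carrier_vec n" "Q *\<^sub>v v = R *\<^sub>v w" using R(3) Q(2) by blast
    have "R * Q *\<^sub>v v = R *\<^sub>v (R *\<^sub>v w)" using Rc Qc v w by simp
    also have "\<dots> = Q *\<^sub>v v" using assoc_mult_mat_vec[OF Rc Rc w(1)] R(2) w(2) by simp
    finally show "R * Q *\<^sub>v v = Q *\<^sub>v v" .
  qed
  fix Q assume Q: "hermitian n Q \<and> Q * Q = Q \<and> {Q *\<^sub>v v | v. v \<in> carrier_vec n} = W"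
  have "Q = P * Q" using absorb[OF P W] Q by simp
  also have "\<dots> = adj (Q * P)" using P Q adj_mult[of Q n n P n] by (simp add: hermitian_def)
  also have "Q * P = P" using absorb[of Q P] Q P W by simp
  finally show "Q = P" using P by (simp add: hermitian_def)
qed (use assms in auto)

lemma index_spec_mat_vec:
  assumes U: "U \<in> carrier_mat n n" and v: "v \<in> carrier_vec n" and i: "i < n"
  shows "(spec_mat n U g *\<^sub>v v) $ i = (\<Sum>k<n. complex_of_real (g k) * cinner (col U k) v * U $$ (i,k))"
proof -
  have "(spec_mat n U g *\<^sub>v v) $ i
      = (\<Sum>j<n. \<Sum>k<n. complex_of_real (g k) * U $$ (i,k) * cnj (U $$ (j,k)) * v $ j)"
    unfolding index_mult_vec_sum[OF spec_mat_carrier[OF U] v i]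
    by (auto intro!: sum.cong simp: index_spec_mat[OF U i] sum_distrib_right)
  also have "\<dots> = (\<Sum>k<n. \<Sum>j<n. complex_of_real (g k) * U $$ (i,k) * cnj (U $$ (j,k)) * v $ j)"
    by (rule sum.swap)
  also have "\<dots> = (\<Sum>k<n. complex_of_real (g k) * cinner (col U k) v * U $$ (i,k))"
    by (rule sum.cong)
      (use U in \<open>auto simp: cinner_sum[OF col_carrier[OF U]] sum_distrib_left sum_distrib_right ac_simps
         intro!: sum.cong\<close>)
  finally show ?thesis .
qed

text \<open>An eigenvector for l is orthogonal to each column whose eigenvalue differs from l. Its
  expansion uses only columns with eigenvalue l, and these are kept because \<open>Q l\<close>
  holds.\<close>

lemma spec_mat_indicator_eigenvector:
  assumes U: "unitary n U" and v: "v \<in> carrier_vec n"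
    and ev: "spec_mat n U e *\<^sub>v v = complex_of_real l \<cdot>\<^sub>v v" and "Q l"
  shows "spec_mat n U (\<lambda>k. if Q (e k) then 1 else 0) *\<^sub>v v = v"
proof -
  have Uc: "U \<in> carrier_mat n n" using U by (rule unitary_carrier)
  note D = spec_mat_carrier[OF Uc]
  have c: "cinner (col U k) v = 0" if k: "k < n" and "e k \<noteq> l" for k
  proof -
    note u = col_carrier[OF Uc, of k]
    have "adj (spec_mat n U e) = spec_mat n U e" using spec_mat_hermitian[OF Uc] by (simp add: hermitian_def)
    hence "complex_of_real l * cinner (col U k) v = cinner (complex_of_real (e k) \<cdot>\<^sub>v col U k) v"
      using cinner_adj[OF D u v, of e] ev cinner_smult_right[OF u v] spec_mat_col[OF U k, of e] by simp
    also have "\<dots> = complex_of_real (e k) * cinner (col U k) v"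
      using cinner_commute[OF v, of "complex_of_real (e k) \<cdot>\<^sub>v col U k"] cinner_commute[OF v u]
        cinner_smult_right[OF v u] u by simp
    finally show ?thesis using \<open>e k \<noteq> l\<close> by simp
  qed
  have "spec_mat n U (\<lambda>k. if Q (e k) then 1 else 0) *\<^sub>v v = spec_mat n U (\<lambda>_. 1) *\<^sub>v v"
  proof (rule eq_vecI)
    fix i assume "i < dim_vec (spec_mat n U (\<lambda>_. 1) *\<^sub>v v)"
    hence i: "i < n" using Uc by simp
    show "(spec_mat n U (\<lambda>k. if Q (e k) then 1 else 0) *\<^sub>v v) $ i = (spec_mat n U (\<lambda>_. 1) *\<^sub>v v) $ i"
      unfolding index_spec_mat_vec[OF Uc v i]
    proof (rule sum.cong[OF refl])
      fix k assume "k \<in> {..<n}"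
      thus "complex_of_real (if Q (e k) then 1 else 0) * cinner (col U k) v * U $$ (i,k)
          = complex_of_real 1 * cinner (col U k) v * U $$ (i,k)"
        using c[of k] \<open>Q l\<close> by (cases "e k = l") auto
    qed
  qed (use D[of "\<lambda>_. 1"] D[of "\<lambda>k. if Q (e k) then 1 else 0"] in auto)
  thus ?thesis using v by (simp add: spec_mat_one[OF U])
qed

lemma foldr_add_vec_carrier:
  fixes vs :: "complex vec list"
  assumes "\<And>v. v \<in> set vs \<Longrightarrow> v \<in> carrier_vec n"
  shows "foldr (+) vs (0\<^sub>v n) \<in> carrier_vec n"
  using assms by (induction vs) auto

lemma foldr_add_vec_index:
  fixes vs :: "complex vec list"
  assumes "\<And>v. v \<in> set vs \<Longrightarrow> v \<in> carrier_vec n" "i < n"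
  shows "foldr (+) vs (0\<^sub>v n) $ i = (\<Sum>v\<leftarrow>vs. v $ i)"
  using assms(1)
proof (induction vs)
  case (Cons v vs)
  thus ?case using foldr_add_vec_carrier[of vs n] assms(2) by simp
qed (use assms in simp)

text \<open>A vector in the range of the indicator projector is the sum of its components along the
  selected columns, each of them an eigenvector. Conversely the projector fixes each admissible
  eigenvector and hence every finite sum of them; the empty list accounts for the zero
  vector.\<close>

lemma eig_span_spec_mat:
  assumes U: "unitary n U"
  shows "{spec_mat n U (\<lambda>k. if Q (e k) then 1 else 0) *\<^sub>v v | v. v \<in> carrier_vec n}
    = eig_span n Q (spec_mat n U e)" (is "{?P *\<^sub>v v | v. _} = _")
proof (intro equalityI subsetI)
  have Uc: "U \<in> carrier_mat n n" using U by (rule unitary_carrier)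
  note P = spec_mat_carrier[OF Uc, of "\<lambda>k. if Q (e k) then 1 else 0"]
  { fix x assume "x \<in> {?P *\<^sub>v v | v. v \<in> carrier_vec n}"
    then obtain v where v: "v \<in> carrier_vec n" and x: "x = ?P *\<^sub>v v" by blast
    \<comment> \<open>The components of v along the selected columns, as a list because
      \<open>eig_span\<close> is built from lists of eigenvectors.\<close>
    define vs where "vs = map (\<lambda>k. cinner (col U k) v \<cdot>\<^sub>v col U k) (filter (\<lambda>k. Q (e k)) [0..<n])"
    have vs: "w \<in> carrier_vec n \<and> (\<exists>l. Q l \<and> spec_mat n U e *\<^sub>v w = complex_of_real l \<cdot>\<^sub>v w)"
      if "w \<in> set vs" for w
    proof -
      obtain k where k: "k < n" "Q (e k)" "w = cinner (col U k) v \<cdot>\<^sub>v col U k"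
        using \<open>w \<in> set vs\<close> by (auto simp: vs_def)
      have "spec_mat n U e *\<^sub>v w = complex_of_real (e k) \<cdot>\<^sub>v w"
        unfolding k(3) mult_mat_vec[OF spec_mat_carrier[OF Uc] col_carrier[OF Uc]] spec_mat_col[OF U k(1)]
        by (simp add: smult_smult_assoc mult.commute)
      thus ?thesis using k col_carrier[OF Uc] by auto
    qed
    have "x = foldr (+) vs (0\<^sub>v n)"
    proof (rule eq_vecI)
      have fc: "foldr (+) vs (0\<^sub>v n) \<in> carrier_vec n" by (rule foldr_add_vec_carrier) (use vs in blast)
      show "dim_vec x = dim_vec (foldr (+) vs (0\<^sub>v n))" using fc Uc x by simp
      fix i assume "i < dim_vec (foldr (+) vs (0\<^sub>v n))"
      hence i: "i < n" using fc by simp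
      have "foldr (+) vs (0\<^sub>v n) $ i = (\<Sum>v\<leftarrow>vs. v $ i)"
        by (rule foldr_add_vec_index) (use vs i in auto)
      also have "\<dots> = (\<Sum>k\<leftarrow>filter (\<lambda>k. Q (e k)) [0..<n]. (cinner (col U k) v \<cdot>\<^sub>v col U k) $ i)"
        by (simp add: vs_def comp_def)
      also have "\<dots> = (\<Sum>k<n. if Q (e k) then (cinner (col U k) v \<cdot>\<^sub>v col U k) $ i else 0)"
        by (simp add: sum_list_map_filter' interv_sum_list_conv_sum_set_nat lessThan_atLeast0)
      also have "\<dots> = x $ i"
        unfolding x index_spec_mat_vec[OF Uc v i] by (rule sum.cong) (use Uc i in auto)
      finally show "x $ i = foldr (+) vs (0\<^sub>v n) $ i" by simp
    qed
    thus "x \<in> eig_span n Q (spec_mat n U e)" unfolding eig_span_def using vs by blast }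
  fix x assume "x \<in> eig_span n Q (spec_mat n U e)"
  then obtain vs where x: "x = foldr (+) vs (0\<^sub>v n)"
    and vs: "\<forall>v \<in> set vs. v \<in> carrier_vec n \<and> (\<exists>l. Q l \<and> spec_mat n U e *\<^sub>v v = complex_of_real l \<cdot>\<^sub>v v)"
    unfolding eig_span_def by blast
  have "?P *\<^sub>v foldr (+) vs (0\<^sub>v n) = foldr (+) vs (0\<^sub>v n) \<and> foldr (+) vs (0\<^sub>v n) \<in> carrier_vec n"
    using vs
  proof (induction vs)
    case Nil
    show ?case using Uc by (auto intro!: eq_vecI)
  next
    case (Cons v vs)
    have "?P *\<^sub>v v = v" using spec_mat_indicator_eigenvector[OF U] Cons.prems by auto
    thus ?case using Cons mult_add_distrib_mat_vec[OF P, of v "foldr (+) vs (0\<^sub>v n)"] by auto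
  qed
  thus "x \<in> {?P *\<^sub>v v | v. v \<in> carrier_vec n}" unfolding x by (intro CollectI exI[of _ "foldr (+) vs (0\<^sub>v n)"]) simp
qed

lemma orth_proj_eig_span:
  assumes U: "unitary n U"
  shows "orth_proj n (eig_span n Q (spec_mat n U e)) = spec_mat n U (\<lambda>k. if Q (e k) then 1 else 0)"
proof (rule orth_proj_eqI)
  show "hermitian n (spec_mat n U (\<lambda>k. if Q (e k) then 1 else 0))"
    by (rule spec_mat_hermitian[OF unitary_carrier[OF U]])
  show "spec_mat n U (\<lambda>k. if Q (e k) then 1 else 0) * spec_mat n U (\<lambda>k. if Q (e k) then 1 else 0)
      = spec_mat n U (\<lambda>k. if Q (e k) then 1 else 0)"
    unfolding spec_mat_mult[OF U] by (rule spec_mat_cong) simp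
qed (rule eig_span_spec_mat[OF U])

lemma P_plus_spec_mat:
  "unitary n U \<Longrightarrow> P_plus n (spec_mat n U e) = spec_mat n U (\<lambda>k. if e k > 0 then 1 else 0)"
  unfolding P_plus_def by (rule orth_proj_eig_span)

lemma P_minus_spec_mat:
  "unitary n U \<Longrightarrow> P_minus n (spec_mat n U e) = spec_mat n U (\<lambda>k. if e k < 0 then 1 else 0)"
  unfolding P_minus_def by (rule orth_proj_eig_span)

lemma P_zero_spec_mat:
  assumes U: "unitary n U"
  shows "P_zero n (spec_mat n U e) = spec_mat n U (\<lambda>k. if e k = 0 then 1 else 0)"
  unfolding P_zero_def P_plus_spec_mat[OF U] P_minus_spec_mat[OF U] spec_mat_one[OF U, symmetric]
    spec_mat_minus[OF unitary_carrier[OF U]]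
  by (rule spec_mat_cong) auto

section \<open>Effects\<close>

lemma psd_minus_form_le:
  assumes "psd n (G - F)" "F \<in> carrier_mat n n" "G \<in> carrier_mat n n" "v \<in> carrier_vec n"
  shows "Re (cinner v (F *\<^sub>v v)) \<le> Re (cinner v (G *\<^sub>v v))"
proof -
  have "0 \<le> Re (cinner v ((G - F) *\<^sub>v v))" using assms by (simp add: psd_def)
  also have "cinner v ((G - F) *\<^sub>v v) = cinner v (G *\<^sub>v v) - cinner v (F *\<^sub>v v)"
    using assms by (simp add: minus_mult_distrib_mat_vec[of _ n n] cinner_diff_right[of _ n])
  finally show ?thesis by simp
qed

lemma Re_trace_mult_spec_mat:
  assumes "U \<in> carrier_mat n n" "T \<in> carrier_mat n n"
  shows "Re (trace (T * spec_mat n U e)) = (\<Sum>k<n. e k * Re (cinner (col U k) (T *\<^sub>v col U k)))"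
  by (simp add: trace_mult_spec_mat[OF assms])

definition effect :: "nat \<Rightarrow> complex mat \<Rightarrow> bool" where
  "effect n F \<longleftrightarrow> psd n F \<and> psd n (1\<^sub>m n - F)"

lemma effect_diag:
  assumes "effect n F" "unitary n U" "k < n"
  shows "0 \<le> Re (cinner (col U k) (F *\<^sub>v col U k))" "Re (cinner (col U k) (F *\<^sub>v col U k)) \<le> 1"
proof -
  note u = col_carrier[OF unitary_carrier[OF assms(2)], of k]
  show "0 \<le> Re (cinner (col U k) (F *\<^sub>v col U k))" using assms(1) u by (simp add: effect_def psd_def)
  have "Re (cinner (col U k) (F *\<^sub>v col U k)) \<le> Re (cinner (col U k) (1\<^sub>m n *\<^sub>v col U k))"
    using psd_minus_form_le[OF _ _ one_carrier_mat u] assms(1) psd_carrier by (simp add: effect_def)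
  thus "Re (cinner (col U k) (F *\<^sub>v col U k)) \<le> 1" using u cinner_col[OF assms(2,3,3)] by simp
qed

text \<open>Without trace, positive and negative eigenvalues carry equal weight, so half the trace
  norm is the positive weight. In the proof the vanishing sum of the \<open>e k\<close> is added and
  \<open>|x| + x = 2 max x 0\<close> is used.\<close>

lemma trace_norm_traceless_spec_mat:
  assumes "unitary n U" "trace (spec_mat n U e) = 0"
  shows "trace_norm n (spec_mat n U e) / 2 = (\<Sum>k<n. max (e k) 0)"
proof -
  have "(\<Sum>k<n. e k) = 0" using assms trace_spec_mat[OF assms(1), of e] by (metis of_real_eq_0_iff)
  hence "(\<Sum>k<n. \<bar>e k\<bar>) = (\<Sum>k<n. \<bar>e k\<bar> + e k)" by (simp add: sum.distrib)
  also have "\<dots> = (\<Sum>k<n. 2 * max (e k) 0)" by (rule sum.cong) auto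
  finally show ?thesis by (simp add: trace_norm_spec_mat[OF assms(1)] sum_distrib_left[symmetric])
qed

text \<open>In an eigenbasis of Y the diagonal entries of F lie between 0 and 1, so each term is at
  most the positive part of its eigenvalue. This is the Helstrom bound for traceless
  operators.\<close>

lemma trace_effect_le:
  assumes "effect n F" "hermitian n Y" "trace Y = 0"
  shows "Re (trace (F * Y)) \<le> trace_norm n Y / 2"
proof -
  obtain U e where U: "unitary n U" and Y: "Y = spec_mat n U e" using hermitian_spectral[OF assms(2)] by blast
  have "Re (trace (F * Y)) = (\<Sum>k<n. e k * Re (cinner (col U k) (F *\<^sub>v col U k)))"
    unfolding Y using assms(1)
    by (intro Re_trace_mult_spec_mat[OF unitary_carrier[OF U]]) (auto simp: effect_def psd_carrier)
  also have "\<dots> \<le> (\<Sum>k<n. max (e k) 0)"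
  proof (rule sum_mono)
    fix k assume "k \<in> {..<n}"
    hence "k < n" by simp
    note q = effect_diag[OF assms(1) U this]
    show "e k * Re (cinner (col U k) (F *\<^sub>v col U k)) \<le> max (e k) 0"
      using q by (cases "e k \<ge> 0") (auto simp: mult_left_le mult_nonpos_nonneg max_def)
  qed
  finally show ?thesis using trace_norm_traceless_spec_mat[OF U] assms(3) by (simp add: Y)
qed

lemma effect_P_plus:
  assumes "hermitian n X"
  shows "effect n (P_plus n X)"
proof -
  obtain U e where U: "unitary n U" and X: "X = spec_mat n U e" using hermitian_spectral[OF assms] by blast
  show ?thesis
    unfolding effect_def X P_plus_spec_mat[OF U] spec_mat_one[OF U, symmetric]
      spec_mat_minus[OF unitary_carrier[OF U]]
    by (auto intro!: spec_mat_psd[OF U])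
qed

lemma trace_P_plus:
  assumes "hermitian n X" "trace X = 0"
  shows "Re (trace (P_plus n X * X)) = trace_norm n X / 2"
proof -
  obtain U e where U: "unitary n U" and X: "X = spec_mat n U e" using hermitian_spectral[OF assms(1)] by blast
  have "Re (trace (P_plus n X * X)) = (\<Sum>k<n. (if e k > 0 then 1 else 0) * e k)"
    unfolding X P_plus_spec_mat[OF U] spec_mat_mult[OF U] trace_spec_mat[OF U] by simp
  also have "\<dots> = (\<Sum>k<n. max (e k) 0)" by (rule sum.cong) auto
  finally show ?thesis using trace_norm_traceless_spec_mat[OF U] assms(2) by (simp add: X)
qed

text \<open>Equality in the bound forces equality in each term, so the diagonal entry
  \<open>q k\<close> is 1 where \<open>e k > 0\<close> and 0 where \<open>e k < 0\<close>.
  \<open>psd_kernel\<close>, applied to \<open>1 - E\<close> and to E respectively, makes the column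
  a fixed vector of E or annihilates it. What remains of E is its compression to the kernel of D,
  and compressions of E and of \<open>1 - E\<close> are psd.\<close>

lemma effect_optimal_decomposition:
  assumes E: "effect n E" and D: "hermitian n D" "trace D = 0"
    and opt: "Re (trace (E * D)) = trace_norm n D / 2"
  shows "psd n (E - P_plus n D)" "psd n (P_zero n D - (E - P_plus n D))"
proof -
  obtain U e where U: "unitary n U" and De: "D = spec_mat n U e" using hermitian_spectral[OF D(1)] by blast
  have Uc: "U \<in> carrier_mat n n" using U by (rule unitary_carrier)
  have Ep: "psd n E" and Em: "psd n (1\<^sub>m n - E)" using E by (auto simp: effect_def)
  have Ec: "E \<in> carrier_mat n n" using Ep by (rule psd_carrier)
  define q where "q k = Re (cinner (col U k) (E *\<^sub>v col U k))" for k
  have q: "0 \<le> q k" "q k \<le> 1" if "k < n" for k using effect_diag[OF E U that] by (simp_all add: q_def)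
  have "(\<Sum>k<n. max (e k) 0) = (\<Sum>k<n. e k * q k)"
    using opt trace_norm_traceless_spec_mat[OF U] D(2) Re_trace_mult_spec_mat[OF Uc Ec, of e]
    by (simp add: De q_def)
  hence "(\<Sum>k<n. max (e k) 0 - e k * q k) = 0" by (simp add: sum_subtractf)
  moreover have "max (e k) 0 - e k * q k \<ge> 0" if "k < n" for k
    using q[OF that] by (cases "e k \<ge> 0") (auto simp: mult_left_le mult_nonpos_nonneg max_def)
  ultimately have "\<forall>k\<in>{..<n}. max (e k) 0 - e k * q k = 0"
    by (subst (asm) sum_nonneg_eq_0_iff) auto
  hence z: "max (e k) 0 = e k * q k" if "k < n" for k using that by simp
  have colE: "E *\<^sub>v col U k = (if e k > 0 then col U k else 0\<^sub>v n)" if k: "k < n" and "e k \<noteq> 0" for k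
  proof (cases "e k > 0")
    case True
    note u = col_carrier[OF Uc, of k]
    have "q k = 1" using z[OF k] True by simp
    moreover have "cinner (col U k) ((1\<^sub>m n - E) *\<^sub>v col U k) = 1 - cinner (col U k) (E *\<^sub>v col U k)"
      using u Ec cinner_col[OF U k k]
      by (simp add: minus_mult_distrib_mat_vec[of _ n n] cinner_diff_right[of _ n])
    ultimately have "(1\<^sub>m n - E) *\<^sub>v col U k = 0\<^sub>v n"
      by (intro psd_kernel[OF Em u]) (simp add: q_def)
    hence *: "col U k - E *\<^sub>v col U k = 0\<^sub>v n" using u Ec by (simp add: minus_mult_distrib_mat_vec[of _ n n])
    have "E *\<^sub>v col U k = col U k"
    proof (rule eq_vecI)
      fix i assume "i < dim_vec (col U k)"
      hence i: "i < n" using Uc by simp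
      have "(col U k - E *\<^sub>v col U k) $ i = 0" unfolding * using i by simp
      thus "(E *\<^sub>v col U k) $ i = col U k $ i" using i Uc Ec by (simp del: index_mult_mat_vec)
    qed (use Uc Ec in simp)
    thus ?thesis using True by simp
  next
    case False
    hence "q k = 0" using z[OF k] \<open>e k \<noteq> 0\<close> by (simp add: max_def)
    thus ?thesis using False psd_kernel[OF Ep col_carrier[OF Uc]] by (simp add: q_def)
  qed
  let ?P = "spec_mat n U (\<lambda>k. if e k > 0 then 1 else 0)" and ?Z = "spec_mat n U (\<lambda>k. if e k = 0 then 1 else 0)"
  note Pc = spec_mat_carrier[OF Uc, of "\<lambda>k. if e k > 0 then 1 else 0"]
  note Zc = spec_mat_carrier[OF Uc, of "\<lambda>k. if e k = 0 then 1 else 0"]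
  let ?nz = "\<lambda>k. if e k = 0 then 0 else 1 :: real"
  \<comment> \<open>E acts as the identity on the positive part and kills the negative part.\<close>
  have EN: "E * spec_mat n U ?nz = ?P"
  proof -
    have "E * U * real_diag n ?nz = U * real_diag n (\<lambda>k. if e k > 0 then 1 else 0)"
    proof (rule eq_matI)
      fix i j assume "i < dim_row (U * real_diag n (\<lambda>k. if e k > 0 then 1 else 0))"
        "j < dim_col (U * real_diag n (\<lambda>k. if e k > 0 then 1 else 0))"
      hence ij: "i < n" "j < n" using Uc by auto
      have "(E * U) $$ (i,j) = (E *\<^sub>v col U j) $ i" using Ec Uc ij by simp
      thus "(E * U * real_diag n ?nz) $$ (i,j) = (U * real_diag n (\<lambda>k. if e k > 0 then 1 else 0)) $$ (i,j)"
        using ij Uc Ec colE[OF ij(2)]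
        by (subst (1 2) index_mult_real_diag) (auto simp del: index_mult_mat(1) index_mult_mat_vec)
    qed (use Uc Ec in auto)
    hence "E * U * real_diag n ?nz * adj U = ?P" by (simp add: spec_mat_def)
    thus ?thesis using Uc Ec by (simp add: spec_mat_def mult_mat_assoc del: assoc_mult_mat)
  qed
  have one: "1\<^sub>m n = spec_mat n U ?nz + ?Z"
    unfolding spec_mat_add[OF Uc] spec_mat_one[OF U, symmetric] by (rule spec_mat_cong) simp
  have EZ: "E = ?P + E * ?Z"
  proof -
    have "E = E * 1\<^sub>m n" using Ec by simp
    also have "\<dots> = ?P + E * ?Z"
      unfolding one using mult_add_distrib_mat[OF Ec spec_mat_carrier[OF Uc] spec_mat_carrier[OF Uc]] EN by simp
    finally show ?thesis .
  qed
  have ZZ: "?Z * ?Z = ?Z" unfolding spec_mat_mult[OF U] by (rule spec_mat_cong) simp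
  have aZ: "adj ?Z = ?Z" and aP: "adj ?P = ?P" using spec_mat_hermitian[OF Uc] by (auto simp: hermitian_def)
  have aE: "adj E = E" using Ep by (simp add: psd_def hermitian_def)
  have EZc: "E * ?Z \<in> carrier_mat n n" using Ec Zc by (metis mult_carrier_mat)
  have diff: "E - ?P = E * ?Z"
  proof -
    have "E - ?P = (?P + E * ?Z) - ?P" using EZ by simp
    also have "\<dots> = E * ?Z" using Pc EZc by (intro eq_matI) auto
    finally show ?thesis .
  qed
  have ZEZ: "E * ?Z = adj ?Z * E * ?Z"
  proof -
    \<comment> \<open>\<open>E * ?Z\<close> equals the Hermitian matrix \<open>E - ?P\<close>, so it
      coincides with its adjoint \<open>?Z * E\<close>.\<close>
    have ZE: "?Z * E = E * ?Z"
    proof -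
      have "?Z * E = adj (E * ?Z)" using adj_mult[OF Ec Zc] aZ aE by simp
      also have "\<dots> = adj (E - ?P)" by (simp only: diff)
      also have "\<dots> = E - ?P" using adj_minus[OF Ec Pc] aE aP by simp
      finally show ?thesis by (simp only: diff)
    qed
    have "adj ?Z * E * ?Z = E * ?Z * ?Z" by (simp only: aZ ZE)
    also have "\<dots> = E * (?Z * ?Z)" by (rule assoc_mult_mat[OF Ec Zc Zc])
    finally show ?thesis by (simp only: ZZ)
  qed
  show "psd n (E - P_plus n D)"
    unfolding De P_plus_spec_mat[OF U] diff ZEZ by (rule psd_congruence[OF Ep Zc])
  \<comment> \<open>The upper bound is the same compression, now of the complementary effect
    \<open>1 - E\<close>.\<close>
  have "?Z - E * ?Z = adj ?Z * (1\<^sub>m n - E) * ?Z"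
  proof -
    have "adj ?Z * (1\<^sub>m n - E) * ?Z = (?Z - ?Z * E) * ?Z"
      using mult_minus_distrib_mat[OF Zc one_carrier_mat Ec] Uc by (simp add: aZ)
    also have "\<dots> = ?Z * ?Z - ?Z * E * ?Z"
      by (rule minus_mult_distrib_mat[OF Zc _ Zc]) (use Zc Ec in \<open>metis mult_carrier_mat\<close>)
    finally show ?thesis using ZEZ by (simp only: ZZ aZ)
  qed
  thus "psd n (P_zero n D - (E - P_plus n D))"
    unfolding De P_plus_spec_mat[OF U] P_zero_spec_mat[OF U] diff
    using psd_congruence[OF Em Zc] by simp
qed

section \<open>Channels\<close>

lemma amplify_one:
  assumes "X \<in> carrier_mat m m" "f X \<in> carrier_mat d d"
  shows "amplify 1 m d f X = f X"
proof -
  have "block m X 0 0 = X" using assms(1) by (auto simp: block_def)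
  thus ?thesis using assms(2) by (intro eq_matI) (auto simp: amplify_def)
qed

text \<open>Positivity is the instance \<open>k = 1\<close> of complete positivity, where
  amplification changes nothing.\<close>

lemma cptp_psd:
  assumes "cptp m d f" "psd m X"
  shows "psd d (f X)"
proof -
  have "f X \<in> carrier_mat d d" using assms psd_carrier[OF assms(2)] by (simp add: cptp_def)
  hence "amplify 1 m d f X = f X" using amplify_one[OF psd_carrier[OF assms(2)]] by simp
  moreover have "psd (1 * d) (amplify 1 m d f X)"
    using assms unfolding cptp_def by (metis nat_mult_1)
  ultimately show ?thesis by simp
qed

lemma cptp_minus:
  assumes "cptp m d f" "X \<in> carrier_mat m m" "Y \<in> carrier_mat m m"
  shows "f (X - Y) = f X - f Y"
proof -
  have fc: "f X \<in> carrier_mat d d" "f Y \<in> carrier_mat d d" using assms by (auto simp: cptp_def)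
  have "X - Y = (-1) \<cdot>\<^sub>m Y + X" using assms by (intro eq_matI) auto
  hence "f (X - Y) = (-1) \<cdot>\<^sub>m f Y + f X" using assms by (simp add: cptp_def)
  also have "\<dots> = f X - f Y" using fc by (intro eq_matI) auto
  finally show ?thesis .
qed

text \<open>Split X into its positive and negative parts: by positivity both images are psd, and by
  linearity the image of X is their difference.\<close>

lemma cptp_hermitian:
  assumes f: "cptp m d f" and X: "hermitian m X"
  shows "hermitian d (f X)"
proof -
  obtain U e where U: "unitary m U" and Xe: "X = spec_mat m U e" using hermitian_spectral[OF X] by blast
  have Uc: "U \<in> carrier_mat m m" using U by (rule unitary_carrier)
  let ?p = "spec_mat m U (\<lambda>k. max (e k) 0)" and ?n = "spec_mat m U (\<lambda>k. max (- e k) 0)"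
  have "X = ?p - ?n" unfolding Xe spec_mat_minus[OF Uc] by (rule spec_mat_cong) auto
  hence "f X = f ?p - f ?n" using cptp_minus[OF f spec_mat_carrier[OF Uc] spec_mat_carrier[OF Uc]] by simp
  moreover have "psd d (f ?p)" "psd d (f ?n)" by (auto intro!: cptp_psd[OF f] spec_mat_psd[OF U])
  ultimately show ?thesis using hermitian_minus psd_hermitian by simp
qed

section \<open>The dual of a channel on effects\<close>

lemma linear_functional_trace:
  fixes \<phi> :: "complex mat \<Rightarrow> complex"
  assumes lin: "\<And>a X Y. X \<in> carrier_mat m m \<Longrightarrow> Y \<in> carrier_mat m m \<Longrightarrow> \<phi> (a \<cdot>\<^sub>m X + Y) = a * \<phi> X + \<phi> Y"
  shows "\<exists>T \<in> carrier_mat m m. \<forall>X \<in> carrier_mat m m. \<phi> X = trace (T * X)"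
proof -
  define u where "u = (\<lambda>(i,j). mat m m (\<lambda>p. if p = (i,j) then 1 else 0 :: complex))"
  \<comment> \<open>The indices are transposed because \<open>Tr (T X)\<close> pairs
    \<open>X $$ (i,j)\<close> with \<open>T $$ (j,i)\<close>.\<close>
  define T where "T = mat m m (\<lambda>(j,i). \<phi> (u (i,j)))"
  have T: "T \<in> carrier_mat m m" by (simp add: T_def)
  have uc: "u p \<in> carrier_mat m m" for p by (simp add: u_def split: prod.splits)
  have "\<phi> X = trace (T * X)" if X: "X \<in> carrier_mat m m" for X
  proof -
    \<comment> \<open>X with all entries outside S erased: adding one position at a time reduces the
      expansion in matrix units to the two-term linearity of \<phi>.\<close>
    define R where "R S = mat m m (\<lambda>p. if p \<in> S then X $$ p else 0)" for S
    have Rc: "R S \<in> carrier_mat m m" for S by (simp add: R_def)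
    have "\<phi> (0\<^sub>m m m) = 2 * \<phi> (0\<^sub>m m m)" using lin[of "0\<^sub>m m m" "0\<^sub>m m m" 1] by simp
    hence zero: "\<phi> (0\<^sub>m m m) = 0" by simp
    have step: "\<phi> (R S) = (\<Sum>p\<in>S. X $$ p * \<phi> (u p))" if "finite S" "S \<subseteq> {..<m} \<times> {..<m}" for S
      using that
    proof (induction S)
      case empty
      have "R {} = 0\<^sub>m m m" by (auto simp: R_def)
      thus ?case using zero by simp
    next
      case (insert p S)
      have "R (insert p S) = X $$ p \<cdot>\<^sub>m u p + R S"
        using insert.hyps insert.prems by (intro eq_matI) (auto simp: R_def u_def split: prod.splits)
      thus ?case using insert lin[OF uc Rc] by simp
    qed
    have "R ({..<m} \<times> {..<m}) = X" using X by (intro eq_matI) (auto simp: R_def)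
    hence "\<phi> X = (\<Sum>p\<in>{..<m} \<times> {..<m}. X $$ p * \<phi> (u p))" using step[of "{..<m} \<times> {..<m}"] by simp
    also have "\<dots> = (\<Sum>i<m. \<Sum>j<m. X $$ (i,j) * \<phi> (u (i,j)))" by (simp add: sum.cartesian_product)
    also have "\<dots> = (\<Sum>i<m. \<Sum>j<m. X $$ (i,j) * T $$ (j,i))" by (auto intro!: sum.cong simp: T_def)
    also have "\<dots> = trace (T * X)" using trace_mult[OF X T] trace_mult_commute[OF X T] by simp
    finally show ?thesis .
  qed
  thus ?thesis using T by blast
qed

definition rank_one :: "nat \<Rightarrow> complex vec \<Rightarrow> complex mat" where
  "rank_one n v = mat n n (\<lambda>(i,j). v $ i * cnj (v $ j))"

lemma rank_one_carrier[simp]: "rank_one n v \<in> carrier_mat n n"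
  by (simp add: rank_one_def)

text \<open>This rewrites the quadratic form of an operator as a trace against a psd operator, so
  that the form of a dual effect can be computed through the channel.\<close>

lemma trace_mult_rank_one:
  assumes "T \<in> carrier_mat n n" "v \<in> carrier_vec n"
  shows "trace (T * rank_one n v) = cinner v (T *\<^sub>v v)"
  unfolding trace_mult[OF assms(1) rank_one_carrier] cinner_mult_vec[OF assms assms(2)]
  by (auto intro!: sum.cong simp: rank_one_def)

lemma psd_rank_one:
  assumes v: "v \<in> carrier_vec n"
  shows "psd n (rank_one n v)"
proof -
  define C where "C = mat 1 n (\<lambda>(i,j). cnj (v $ j))"
  have C: "C \<in> carrier_mat 1 n" by (simp add: C_def)
  have "adj C * C = rank_one n v"
  proof (rule eq_matI)
    fix i j assume "i < dim_row (rank_one n v)" "j < dim_col (rank_one n v)"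
    hence ij: "i < n" "j < n" by (auto simp: rank_one_def)
    have "(adj C * C) $$ (i,j) = (\<Sum>k<1. adj C $$ (i,k) * C $$ (k,j))"
      by (rule index_mult_mat_sum) (use C ij in auto)
    thus "(adj C * C) $$ (i,j) = rank_one n v $$ (i,j)" using ij by (simp add: C_def rank_one_def)
  qed (use C in \<open>auto simp: rank_one_def\<close>)
  thus ?thesis using psd_gram[OF C] by simp
qed

text \<open>E is the Heisenberg picture of F. Its form at v is the trace of F against the image of
  the rank-one operator of v, so positivity of f gives \<open>E \<ge> 0\<close>. The same argument
  for \<open>1 - F\<close>, together with trace preservation, gives
  \<open>E \<le> 1\<close>.\<close>

lemma cptp_dual_effect:
  assumes f: "cptp m d f" and F: "effect d F"
  shows "\<exists>E. effect m E \<and> (\<forall>X. hermitian m X \<longrightarrow> Re (trace (E * X)) = Re (trace (F * f X)))"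
proof -
  have Fp: "psd d F" and Fm: "psd d (1\<^sub>m d - F)" using F by (auto simp: effect_def)
  have Fc: "F \<in> carrier_mat d d" using Fp by (rule psd_carrier)
  have fc: "f X \<in> carrier_mat d d" if "X \<in> carrier_mat m m" for X using f that by (simp add: cptp_def)
  have "trace (F * f (a \<cdot>\<^sub>m X + Y)) = a * trace (F * f X) + trace (F * f Y)"
    if "X \<in> carrier_mat m m" "Y \<in> carrier_mat m m" for a X Y
  proof -
    have "f (a \<cdot>\<^sub>m X + Y) = a \<cdot>\<^sub>m f X + f Y" using f that by (simp add: cptp_def)
    moreover have "F * (a \<cdot>\<^sub>m f X + f Y) = a \<cdot>\<^sub>m (F * f X) + F * f Y"
      using mult_add_distrib_mat[OF Fc _ fc[OF that(2)], of "a \<cdot>\<^sub>m f X"]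
        mult_smult_distrib[OF Fc fc[OF that(1)], of a] fc that by simp
    moreover have "F * f X \<in> carrier_mat d d" "F * f Y \<in> carrier_mat d d"
      using Fc fc that by auto
    ultimately show ?thesis by (simp add: trace_add[of _ d] trace_smult[of _ d])
  qed
  from linear_functional_trace[OF this] obtain T where T: "T \<in> carrier_mat m m"
    and tr: "\<And>X. X \<in> carrier_mat m m \<Longrightarrow> trace (F * f X) = trace (T * X)" by blast
  \<comment> \<open>Passing to the Hermitian part of T spares us showing that T is itself Hermitian.\<close>
  define E where "E = (1/2) \<cdot>\<^sub>m (T + adj T)"
  have Ec: "E \<in> carrier_mat m m" using T by (simp add: E_def)
  have hE: "hermitian m E" unfolding hermitian_def
  proof
    show "adj E = E" unfolding E_def using T by (intro eq_matI) (auto simp: add.commute)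
  qed (rule Ec)
  have trE: "Re (trace (E * X)) = Re (trace (F * f X))" if X: "hermitian m X" for X
  proof -
    have Xc: "X \<in> carrier_mat m m" and aX: "adj X = X" using X by (auto simp: hermitian_def)
    have aT: "adj T \<in> carrier_mat m m" using T by simp
    have "trace (adj T * X) = trace (adj (X * T))" using adj_mult[OF Xc T] aX by simp
    also have "\<dots> = cnj (trace (X * T))" by (rule trace_adj[of _ m]) (use Xc T in auto)
    also have "trace (X * T) = trace (T * X)" by (rule trace_mult_commute[OF Xc T])
    finally have *: "trace (adj T * X) = cnj (trace (T * X))" .
    have "E * X = (1/2) \<cdot>\<^sub>m (T * X + adj T * X)"
      unfolding E_def using mult_smult_assoc_mat[of "T + adj T" m m X m] add_mult_distrib_mat[OF T aT Xc] T Xc by simp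
    moreover have "T * X \<in> carrier_mat m m" "adj T * X \<in> carrier_mat m m" using T Xc by auto
    ultimately have "trace (E * X) = (1/2) * (trace (T * X) + trace (adj T * X))"
      by (simp add: trace_smult[of _ m] trace_add[of _ m])
    from arg_cong[OF this, of Re] show ?thesis using * tr[OF Xc] by simp
  qed
  have "psd m E" unfolding psd_def
  proof (intro conjI ballI hE)
    fix v :: "complex vec" assume v: "v \<in> carrier_vec m"
    have "0 \<le> Re (trace (F * f (rank_one m v)))"
      by (rule trace_mult_psd_nonneg[OF Fp cptp_psd[OF f psd_rank_one[OF v]]])
    thus "0 \<le> Re (cinner v (E *\<^sub>v v))"
      using trE[OF psd_hermitian[OF psd_rank_one[OF v]]] trace_mult_rank_one[OF Ec v] by simp
  qed
  moreover have "psd m (1\<^sub>m m - E)" unfolding psd_def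
  proof (intro conjI ballI)
    show "hermitian m (1\<^sub>m m - E)" by (rule hermitian_minus[OF _ hE]) (simp add: hermitian_def)
    fix v :: "complex vec" assume v: "v \<in> carrier_vec m"
    let ?r = "rank_one m v"
    have rc: "f ?r \<in> carrier_mat d d" by (rule fc) simp
    have "0 \<le> Re (trace ((1\<^sub>m d - F) * f ?r))"
      by (rule trace_mult_psd_nonneg[OF Fm cptp_psd[OF f psd_rank_one[OF v]]])
    also have "(1\<^sub>m d - F) * f ?r = f ?r - F * f ?r"
      using minus_mult_distrib_mat[OF one_carrier_mat Fc rc] rc by simp
    also have "trace \<dots> = trace (f ?r) - trace (F * f ?r)" by (rule trace_minus[OF rc]) (use Fc rc in auto)
    \<comment> \<open>Trace preservation of f enters here; dually it says that the identity is sent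
      to the identity.\<close>
    also have "trace (f ?r) = trace (1\<^sub>m m * ?r)" using f left_mult_one_mat[of ?r m m] by (simp add: cptp_def)
    also have "\<dots> = cinner v v" using trace_mult_rank_one[OF one_carrier_mat v] v by simp
    finally have "0 \<le> Re (cinner v v) - Re (cinner v (E *\<^sub>v v))"
      using trE[OF psd_hermitian[OF psd_rank_one[OF v]]] trace_mult_rank_one[OF Ec v] by simp
    moreover have "cinner v ((1\<^sub>m m - E) *\<^sub>v v) = cinner v v - cinner v (E *\<^sub>v v)"
      using v Ec by (simp add: minus_mult_distrib_mat_vec[of _ m m] cinner_diff_right[of _ m])
    ultimately show "0 \<le> Re (cinner v ((1\<^sub>m m - E) *\<^sub>v v))" by simp
  qed
  ultimately show ?thesis using trE by (auto simp: effect_def)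
qed

section \<open>Complete positivity of measure-and-prepare maps\<close>

lemma sum_lessThan_mult:
  fixes h :: "nat \<Rightarrow> complex"
  shows "(\<Sum>i<k * m. h i) = (\<Sum>a<k. \<Sum>p<m. h (a * m + p))"
proof -
  have "(\<Sum>i<k * m. h i) = (\<Sum>a<k. sum h {a * m..<a * m + m})" by (rule sum.nat_group[symmetric])
  also have "\<dots> = (\<Sum>a<k. \<Sum>p<m. h (a * m + p))"
    by (rule sum.cong[OF refl], subst sum.atLeastLessThan_shift_0) (simp add: lessThan_atLeast0)
  finally show ?thesis .
qed

lemma mult_add_less:
  fixes a k n p :: nat
  assumes "a < k" "p < n"
  shows "a * n + p < k * n"
proof -
  have "a * n + p < (a + 1) * n" using assms by simp
  also have "\<dots> \<le> k * n" using assms by (intro mult_right_mono) auto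
  finally show ?thesis .
qed

text \<open>This is complete positivity of the functional \<open>X \<mapsto> Tr (T X)\<close>. With
  \<open>T = S * S\<close>, the trace of T against a block is the sum over the columns of S of the
  form of that block, so the whole expression is a sum of values of the form of M.\<close>

lemma block_trace_form_nonneg:
  assumes M: "psd (k * m) M" and T: "psd m T"
  shows "0 \<le> Re (\<Sum>a<k. \<Sum>b<k. cnj (c a) * trace (T * block m M a b) * c b)"
proof -
  obtain S where S: "psd m S" and SS: "S * S = T" using psd_sqrt_exists[OF T] by blast
  have Sc: "S \<in> carrier_mat m m" and aS: "adj S = S" using S by (auto simp: psd_def hermitian_def)
  have Mc: "M \<in> carrier_mat (k * m) (k * m)" using M by (rule psd_carrier)
  have sym: "S $$ (l,p) = cnj (S $$ (p,l))" if "l < m" "p < m" for l p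
    using index_adj[of l S p] Sc aS that by simp
  \<comment> \<open>The tensor product of \<open>c\<close> with the l-th column of S, flattened by
    the index convention of \<open>block\<close>.\<close>
  define x where "x l = vec (k * m) (\<lambda>i. c (i div m) * S $$ (i mod m, l))" for l
  have xc: "x l \<in> carrier_vec (k * m)" for l by (simp add: x_def)
  have xi: "x l $ (a * m + p) = c a * S $$ (p,l)" if "a < k" "p < m" for a p l
    using mult_add_less[OF that] that by (simp add: x_def)
  have tr: "trace (T * block m M a b)
      = (\<Sum>l<m. \<Sum>p<m. \<Sum>q<m. cnj (S $$ (p,l)) * M $$ (a * m + p, b * m + q) * S $$ (q,l))" for a b
  proof -
    let ?B = "block m M a b"
    have Bc: "?B \<in> carrier_mat m m" by (simp add: block_def)
    have BSc: "?B * S \<in> carrier_mat m m" using Bc Sc by auto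
    have "T * ?B = S * (S * ?B)" unfolding SS[symmetric] by (rule assoc_mult_mat[OF Sc Sc Bc])
    \<comment> \<open>Cyclicity puts one factor S on either side of the block, so that the diagonal
      entries become forms at the columns of S.\<close>
    hence "trace (T * ?B) = trace (S * ?B * S)"
      using trace_mult_commute[of S m m "S * ?B"] Sc Bc by simp
    also have "\<dots> = trace (S * (?B * S))" using assoc_mult_mat[OF Sc Bc Sc] by simp
    also have "\<dots> = (\<Sum>l<m. \<Sum>p<m. S $$ (l,p) * (?B * S) $$ (p,l))" by (rule trace_mult[OF Sc BSc])
    also have "\<dots> = (\<Sum>l<m. \<Sum>p<m. S $$ (l,p) * (\<Sum>q<m. ?B $$ (p,q) * S $$ (q,l)))"
      by (intro sum.cong refl) (simp add: index_mult_mat_sum[OF Bc Sc] del: index_mult_mat(1))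
    also have "\<dots> = (\<Sum>l<m. \<Sum>p<m. \<Sum>q<m. cnj (S $$ (p,l)) * M $$ (a * m + p, b * m + q) * S $$ (q,l))"
      unfolding sum_distrib_left by (intro sum.cong refl) (simp add: sym[symmetric] block_def mult.assoc)
    finally show ?thesis .
  qed
  have "(\<Sum>a<k. \<Sum>b<k. cnj (c a) * trace (T * block m M a b) * c b)
      = (\<Sum>a<k. \<Sum>b<k. \<Sum>l<m. \<Sum>p<m. \<Sum>q<m.
          cnj (x l $ (a * m + p)) * M $$ (a * m + p, b * m + q) * x l $ (b * m + q))"
    unfolding tr sum_distrib_left sum_distrib_right
    by (intro sum.cong refl) (simp add: xi)
  \<comment> \<open>The exchanges of summation bring l to the front and pair the rest as (a,p) and
    (b,q), the row and column indices of M.\<close>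
  also have "\<dots> = (\<Sum>a<k. \<Sum>l<m. \<Sum>b<k. \<Sum>p<m. \<Sum>q<m.
          cnj (x l $ (a * m + p)) * M $$ (a * m + p, b * m + q) * x l $ (b * m + q))"
    by (rule sum.cong[OF refl], rule sum.swap)
  also have "\<dots> = (\<Sum>l<m. \<Sum>a<k. \<Sum>b<k. \<Sum>p<m. \<Sum>q<m.
          cnj (x l $ (a * m + p)) * M $$ (a * m + p, b * m + q) * x l $ (b * m + q))"
    by (rule sum.swap)
  also have "\<dots> = (\<Sum>l<m. \<Sum>a<k. \<Sum>p<m. \<Sum>b<k. \<Sum>q<m.
          cnj (x l $ (a * m + p)) * M $$ (a * m + p, b * m + q) * x l $ (b * m + q))"
    by (rule sum.cong[OF refl], rule sum.cong[OF refl], rule sum.swap)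
  also have "\<dots> = (\<Sum>l<m. cinner (x l) (M *\<^sub>v x l))"
    unfolding cinner_mult_vec[OF Mc xc xc] sum_lessThan_mult ..
  finally have "Re (\<Sum>a<k. \<Sum>b<k. cnj (c a) * trace (T * block m M a b) * c b)
      = (\<Sum>l<m. Re (cinner (x l) (M *\<^sub>v x l)))" by simp
  also have "\<dots> \<ge> 0" using M xc by (intro sum_nonneg) (simp add: psd_def)
  finally show ?thesis .
qed

text \<open>For a POVM \<open>T\<close> this is the quantum-to-classical channel that stores outcome
  i as the i-th basis state.\<close>

definition measure_prepare :: "nat \<Rightarrow> (nat \<Rightarrow> complex mat) \<Rightarrow> complex mat \<Rightarrow> complex mat" where
  "measure_prepare d T X = mat d d (\<lambda>(i,j). if i = j then trace (T i * X) else 0)"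

lemma trace_mult_adj:
  assumes "hermitian m T" "X \<in> carrier_mat m m"
  shows "trace (T * adj X) = cnj (trace (T * X))"
proof -
  have T: "T \<in> carrier_mat m m" "adj T = T" using assms(1) by (auto simp: hermitian_def)
  have "cnj (trace (T * X)) = trace (adj (T * X))" by (rule trace_adj[of _ m, symmetric]) (use T assms in auto)
  also have "\<dots> = trace (adj X * T)" using adj_mult[OF T(1) assms(2)] T by simp
  also have "\<dots> = trace (T * adj X)" by (rule trace_mult_commute[of _ m m]) (use T assms in auto)
  finally show ?thesis by simp
qed

text \<open>Since outputs are diagonal, the form of the amplified output splits over the outcomes r.
  Each part is the form of \<open>block_trace_form_nonneg\<close> for \<open>T r\<close>, with
  coefficients \<open>c a = v $ (a * d + r)\<close>. Completeness of the POVM is assumed through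
  traces, which avoids a sum of matrices.\<close>

lemma measure_prepare_cptp:
  assumes T: "\<And>i. i < d \<Longrightarrow> psd m (T i)"
    and sum_one: "\<And>X. X \<in> carrier_mat m m \<Longrightarrow> (\<Sum>i<d. trace (T i * X)) = trace X"
  shows "cptp m d (measure_prepare d T)"
  unfolding cptp_def
proof (intro conjI ballI allI impI)
  fix X :: "complex mat" assume X: "X \<in> carrier_mat m m"
  show "measure_prepare d T X \<in> carrier_mat d d" by (simp add: measure_prepare_def)
  show "trace (measure_prepare d T X) = trace X"
    using sum_one[OF X] by (simp add: measure_prepare_def trace_def[of "mat d d _"])
  fix Y :: "complex mat" and a :: complex assume Y: "Y \<in> carrier_mat m m"
  have "trace (T i * (a \<cdot>\<^sub>m X + Y)) = a * trace (T i * X) + trace (T i * Y)" if "i < d" for i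
  proof -
    have Tc: "T i \<in> carrier_mat m m" using T[OF that] by (rule psd_carrier)
    have "T i * (a \<cdot>\<^sub>m X + Y) = a \<cdot>\<^sub>m (T i * X) + T i * Y"
      using mult_add_distrib_mat[OF Tc _ Y, of "a \<cdot>\<^sub>m X"] mult_smult_distrib[OF Tc X, of a] X by simp
    moreover have "T i * X \<in> carrier_mat m m" "T i * Y \<in> carrier_mat m m" using Tc X Y by auto
    ultimately show ?thesis by (simp add: trace_add[of _ m] trace_smult[of _ m])
  qed
  thus "measure_prepare d T (a \<cdot>\<^sub>m X + Y) = a \<cdot>\<^sub>m measure_prepare d T X + measure_prepare d T Y"
    by (intro eq_matI) (auto simp: measure_prepare_def)
next
  fix k M assume M: "psd (k * m) M"
  have Mc: "M \<in> carrier_mat (k * m) (k * m)" and aM: "adj M = M" using M by (auto simp: psd_def hermitian_def)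
  let ?A = "amplify k m d (measure_prepare d T) M"
  have Ac: "?A \<in> carrier_mat (k * d) (k * d)" by (simp add: amplify_def)
  have Aij: "?A $$ (i,j) = (if i mod d = j mod d then trace (T (i mod d) * block m M (i div d) (j div d)) else 0)"
    if "i < k * d" "j < k * d" for i j
  proof -
    \<comment> \<open>An index below \<open>k * d\<close> excludes \<open>d = 0\<close>, and this
      makes \<open>i mod d\<close> a valid outcome.\<close>
    have "0 < d" using that by (cases d) auto
    thus ?thesis using that by (simp add: amplify_def measure_prepare_def)
  qed
  have block_adj: "block m M b a = adj (block m M a b)" if "a < k" "b < k" for a b
  proof (rule eq_matI)
    fix i j assume "i < dim_row (adj (block m M a b))" "j < dim_col (adj (block m M a b))"
    hence ij: "i < m" "j < m" by (auto simp: block_def)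
    have "M $$ (b * m + i, a * m + j) = adj M $$ (b * m + i, a * m + j)" using aM by simp
    thus "block m M b a $$ (i,j) = adj (block m M a b) $$ (i,j)"
      using ij mult_add_less that Mc by (simp add: block_def)
  qed (auto simp: block_def)
  show "psd (k * d) ?A" unfolding psd_def
  proof (intro conjI ballI)
    show "hermitian (k * d) ?A" unfolding hermitian_def
    proof (intro conjI Ac eq_matI)
      fix i j assume "i < dim_row ?A" "j < dim_col ?A"
      hence ij: "i < k * d" "j < k * d" using Ac by auto
      have d: "0 < d" using ij by (cases d) auto
      have dv: "i div d < k" "j div d < k" using ij by (auto intro: less_mult_imp_div_less)
      have "adj ?A $$ (i,j) = cnj (?A $$ (j,i))" using ij Ac by simp
      also have "\<dots> = ?A $$ (i,j)"
        unfolding Aij[OF ij] Aij[OF ij(2,1)] block_adj[OF dv(2,1)]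
        using trace_mult_adj[OF psd_hermitian[OF T], of "j mod d" "block m M (j div d) (i div d)"] d
        by (auto simp: block_def)
      finally show "adj ?A $$ (i,j) = ?A $$ (i,j)" .
    qed (use Ac in auto)
    fix v :: "complex vec" assume v: "v \<in> carrier_vec (k * d)"
    have "cinner v (?A *\<^sub>v v) = (\<Sum>a<k. \<Sum>r<d. \<Sum>b<k. \<Sum>s<d.
        cnj (v $ (a * d + r)) * ?A $$ (a * d + r, b * d + s) * v $ (b * d + s))"
      unfolding cinner_mult_vec[OF Ac v v] sum_lessThan_mult ..
    \<comment> \<open>Distinct outcomes r and s do not interfere, since the output of each block is
      diagonal.\<close>
    also have "\<dots> = (\<Sum>a<k. \<Sum>r<d. \<Sum>b<k. \<Sum>s<d. if s = r then
        cnj (v $ (a * d + r)) * trace (T r * block m M a b) * v $ (b * d + r) else 0)"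
      by (intro sum.cong refl) (auto simp: Aij mult_add_less)
    also have "\<dots> = (\<Sum>a<k. \<Sum>r<d. \<Sum>b<k.
        cnj (v $ (a * d + r)) * trace (T r * block m M a b) * v $ (b * d + r))"
      by (intro sum.cong refl) simp
    also have "\<dots> = (\<Sum>r<d. \<Sum>a<k. \<Sum>b<k.
        cnj (v $ (a * d + r)) * trace (T r * block m M a b) * v $ (b * d + r))"
      by (rule sum.swap)
    finally have "Re (cinner v (?A *\<^sub>v v)) = (\<Sum>r<d. Re (\<Sum>a<k. \<Sum>b<k.
        cnj (v $ (a * d + r)) * trace (T r * block m M a b) * v $ (b * d + r)))" by simp
    also have "\<dots> \<ge> 0" using block_trace_form_nonneg[OF M T] by (intro sum_nonneg) auto
    finally show "0 \<le> Re (cinner v (?A *\<^sub>v v))" .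
  qed
qed

section \<open>Binary measurements\<close>

lemma psd_zero_mat: "psd n (0\<^sub>m n n)"
proof -
  have "adj (0\<^sub>m n n) = 0\<^sub>m n n" by (rule eq_matI) auto
  thus ?thesis using psd_gram[of "0\<^sub>m n n" n n] by simp
qed

text \<open>In an eigenbasis of D, the bound \<open>E \<le> P0\<close> kills the diagonal entries of
  E at nonzero eigenvalues, and the other entries are multiplied by the eigenvalue 0.\<close>

lemma trace_effect_below_P_zero:
  assumes D: "hermitian n D" and E: "psd n E" "psd n (P_zero n D - E)"
  shows "Re (trace (E * D)) = 0"
proof -
  obtain U e where U: "unitary n U" and De: "D = spec_mat n U e" using hermitian_spectral[OF D] by blast
  have Uc: "U \<in> carrier_mat n n" using U by (rule unitary_carrier)
  have Ec: "E \<in> carrier_mat n n" using E(1) by (rule psd_carrier)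
  have "e k * Re (cinner (col U k) (E *\<^sub>v col U k)) = 0" if k: "k < n" for k
  proof (cases "e k = 0")
    case False
    note u = col_carrier[OF Uc, of k]
    have "Re (cinner (col U k) (E *\<^sub>v col U k)) \<le> Re (cinner (col U k) (P_zero n D *\<^sub>v col U k))"
      by (rule psd_minus_form_le[OF E(2) Ec _ u]) (simp add: De P_zero_spec_mat[OF U] Uc)
    also have "\<dots> = 0"
      using False by (simp add: De P_zero_spec_mat[OF U] spec_mat_col[OF U k] cinner_smult_right[OF u u])
    finally have "Re (cinner (col U k) (E *\<^sub>v col U k)) = 0" using E(1) u by (force simp: psd_def)
    thus ?thesis by simp
  qed simp
  thus ?thesis unfolding De Re_trace_mult_spec_mat[OF Uc Ec] by (intro sum.neutral ballI) simp
qed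

text \<open>Outcomes 0 and 1 carry the measurement; the zero effects pad the output to dimension
  d.\<close>

definition binary_measurement :: "nat \<Rightarrow> nat \<Rightarrow> complex mat \<Rightarrow> complex mat \<Rightarrow> complex mat" where
  "binary_measurement m d E = measure_prepare d (\<lambda>i. if i = 0 then E else if i = 1 then 1\<^sub>m m - E else 0\<^sub>m m m)"

lemma binary_measurement_cptp:
  assumes E: "effect m E" and d: "d \<ge> 2"
  shows "cptp m d (binary_measurement m d E)"
  unfolding binary_measurement_def
proof (rule measure_prepare_cptp)
  fix X :: "complex mat" assume X: "X \<in> carrier_mat m m"
  have Ec: "E \<in> carrier_mat m m" using E psd_carrier by (simp add: effect_def)
  obtain d' where d': "d = Suc (Suc d')" using d by (metis Suc_le_D numeral_2_eq_2 Suc_le_mono)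
  have "(1\<^sub>m m - E) * X = X - E * X"
    using minus_mult_distrib_mat[OF one_carrier_mat Ec X] X by simp
  moreover have "trace (X - E * X) = trace X - trace (E * X)"
    by (rule trace_minus[OF X]) (use Ec X in auto)
  moreover have "trace (0\<^sub>m m m * X) = 0" using X by (simp add: trace_def)
  ultimately show "(\<Sum>i<d. trace ((if i = 0 then E else if i = 1 then 1\<^sub>m m - E else 0\<^sub>m m m) * X)) = trace X"
    unfolding d' sum.lessThan_Suc_shift by simp
qed (use E psd_zero_mat in \<open>auto simp: effect_def\<close>)

text \<open>As X is traceless, the two outcomes have opposite weights t and -t with
  \<open>t = Tr (E X)\<close>. The output is diagonal with these two entries followed by
  zeros.\<close>

lemma trace_norm_binary_measurement:
  assumes E: "effect m E" and d: "d \<ge> 2" and X: "hermitian m X" "trace X = 0"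
  shows "trace_norm d (binary_measurement m d E X) = 2 * \<bar>Re (trace (E * X))\<bar>"
proof -
  have Ec: "E \<in> carrier_mat m m" and hE: "hermitian m E"
    using E psd_carrier psd_hermitian by (auto simp: effect_def)
  have Xc: "X \<in> carrier_mat m m" "adj X = X" using X by (auto simp: hermitian_def)
  obtain d' where d': "d = Suc (Suc d')" using d by (metis Suc_le_D numeral_2_eq_2 Suc_le_mono)
  define t where "t = Re (trace (E * X))"
  \<comment> \<open>The trace of a product of two Hermitian operators equals its own conjugate,
    hence is real.\<close>
  have t: "trace (E * X) = complex_of_real t"
    using trace_mult_adj[OF hE Xc(1)] Xc(2) by (simp add: t_def complex_eq_iff)
  have "(1\<^sub>m m - E) * X = X - E * X"
    using minus_mult_distrib_mat[OF one_carrier_mat Ec Xc(1)] Xc by simp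
  moreover have "trace (X - E * X) = trace X - trace (E * X)"
    by (rule trace_minus[OF Xc(1)]) (use Ec Xc in auto)
  ultimately have t': "trace ((1\<^sub>m m - E) * X) = - complex_of_real t" using t X(2) by simp
  have z: "trace (0\<^sub>m m m * X) = 0" using Xc by (simp add: trace_def)
  define g where "g i = (if i = 0 then t else if i = 1 then - t else 0)" for i :: nat
  have u: "unitary d (1\<^sub>m d)" by (simp add: unitary_def)
  have "binary_measurement m d E X = spec_mat d (1\<^sub>m d) g"
    by (rule eq_matI) (auto simp: binary_measurement_def measure_prepare_def spec_mat_def real_diag_def g_def t t' z)
  hence "trace_norm d (binary_measurement m d E X) = (\<Sum>i<d. \<bar>g i\<bar>)"
    by (simp add: trace_norm_spec_mat[OF u])
  also have "\<dots> = 2 * \<bar>t\<bar>" unfolding d' sum.lessThan_Suc_shift by (simp add: g_def)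
  finally show ?thesis by (simp add: t_def)
qed

section \<open>The equivalence\<close>

theorem theorem1:
  fixes m d :: nat and A B :: "complex mat"
  assumes "m \<ge> 1"
    and "hermitian m A" and "trace A = 0"
    and "hermitian m B" and "trace B = 0"
    and "d \<ge> 2"
  shows "(\<exists>f. cptp m d f \<and>
            trace_norm d (f A) - trace_norm d (f B) = trace_norm d (f (A - B)) \<and>
            trace_norm d (f (A - B)) = trace_norm m (A - B))
     \<longleftrightarrow>
         (\<exists>E0. psd m E0 \<and> psd m (P_zero m (A - B) - E0) \<and>
            Re (trace (P_plus m (A - B) * A)) + Re (trace (E0 * A))
              \<ge> Re (trace (P_plus m (A - B) * B)) + Re (trace (E0 * B)) \<and>
            Re (trace (P_plus m (A - B) * B)) + Re (trace (E0 * B)) \<ge> 0)"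
    (is "?channel \<longleftrightarrow> ?operator")
proof -
  let ?D = "A - B" and ?P = "P_plus m (A - B)"
  have Ac: "A \<in> carrier_mat m m" and Bc: "B \<in> carrier_mat m m"
    using assms hermitian_carrier by auto
  have D: "hermitian m ?D" "trace ?D = 0"
    using hermitian_minus[OF assms(2,4)] trace_minus[OF Ac Bc] assms by auto
  have Pp: "psd m ?P" and Pc: "?P \<in> carrier_mat m m"
    using effect_P_plus[OF D(1)] psd_carrier by (auto simp: effect_def)
  have tr_sum: "Re (trace ((?P + E0) * X)) = Re (trace (?P * X)) + Re (trace (E0 * X))"
    if "E0 \<in> carrier_mat m m" "X \<in> carrier_mat m m" for E0 X
  proof -
    have "?P * X \<in> carrier_mat m m" "E0 * X \<in> carrier_mat m m" using Pc that by auto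
    thus ?thesis using add_mult_distrib_mat[OF Pc that] by (simp add: trace_add[of _ m])
  qed
  have tr_diff: "Re (trace (T * ?D)) = Re (trace (T * A)) - Re (trace (T * B))"
    if "T \<in> carrier_mat m m" for T
  proof -
    have "T * A \<in> carrier_mat m m" "T * B \<in> carrier_mat m m" using Ac Bc that by auto
    thus ?thesis using mult_minus_distrib_mat[OF that Ac Bc] by (simp add: trace_minus[of _ m])
  qed
  show ?thesis
  proof
    assume ?channel
    then obtain f where f: "cptp m d f"
      and eq1: "trace_norm d (f A) - trace_norm d (f B) = trace_norm d (f ?D)"
      and eq2: "trace_norm d (f ?D) = trace_norm m ?D" by blast
    have h: "hermitian d (f A)" "hermitian d (f B)" "hermitian d (f ?D)"
      using cptp_hermitian[OF f] assms D by auto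
    have tr0: "trace (f A) = 0" "trace (f B) = 0" "trace (f ?D) = 0"
      using f Ac Bc hermitian_carrier[OF D(1)] assms D(2) by (simp_all add: cptp_def)
    \<comment> \<open>The projector is taken for \<open>f A\<close>, the operator whose norm is the
      sum of the other two: exactness there leaves no slack in the upper bounds for
      \<open>f B\<close> and \<open>f (A - B)\<close>.\<close>
    let ?F = "P_plus d (f A)"
    have F: "effect d ?F" by (rule effect_P_plus[OF h(1)])
    obtain E where E: "effect m E"
      and dual: "\<And>X. hermitian m X \<Longrightarrow> Re (trace (E * X)) = Re (trace (?F * f X))"
      using cptp_dual_effect[OF f F] by blast
    have Ec: "E \<in> carrier_mat m m" using E psd_carrier by (simp add: effect_def)
    have "Re (trace (E * A)) = trace_norm d (f A) / 2"
      using dual[OF assms(2)] trace_P_plus[OF h(1) tr0(1)] by simp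
    moreover have "Re (trace (E * B)) \<le> trace_norm d (f B) / 2"
      using dual[OF assms(4)] trace_effect_le[OF F h(2) tr0(2)] by simp
    moreover have "Re (trace (E * ?D)) \<le> trace_norm d (f ?D) / 2"
      using dual[OF D(1)] trace_effect_le[OF F h(3) tr0(3)] by simp
    \<comment> \<open>\<open>Tr (E A) = Tr (E B) + Tr (E D)\<close>, and the hypothesis splits
      \<open>||f A||\<close> in the same way. Two upper bounds whose sum is attained are both
      attained; the preserved norm then replaces \<open>||f D||\<close> by
      \<open>||D||\<close>.\<close>
    ultimately have EB: "Re (trace (E * B)) = trace_norm d (f B) / 2"
      and ED: "Re (trace (E * ?D)) = trace_norm m ?D / 2"
      using tr_diff[OF Ec] eq1 eq2 by auto
    have nonneg: "0 \<le> trace_norm n X" if "hermitian n X" for n X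
    proof -
      obtain U e where "unitary n U" "X = spec_mat n U e" using hermitian_spectral[OF \<open>hermitian n X\<close>] by blast
      thus ?thesis by (simp add: trace_norm_spec_mat sum_nonneg)
    qed
    let ?E0 = "E - ?P"
    have E0: "psd m ?E0" "psd m (P_zero m ?D - ?E0)"
      using effect_optimal_decomposition[OF E D ED] by auto
    have "?P + ?E0 = E" using Pc Ec by (intro eq_matI) auto
    hence split: "Re (trace (?P * X)) + Re (trace (?E0 * X)) = Re (trace (E * X))"
      if "X \<in> carrier_mat m m" for X
      using tr_sum[OF psd_carrier[OF E0(1)] that] by simp
    show ?operator
    proof (intro exI[of _ ?E0] conjI E0)
      \<comment> \<open>The difference of the two sides is \<open>Tr (E D)\<close>, that is half the
        norm of D.\<close>
      show "Re (trace (?P * A)) + Re (trace (?E0 * A)) \<ge> Re (trace (?P * B)) + Re (trace (?E0 * B))"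
        unfolding split[OF Ac] split[OF Bc] using tr_diff[OF Ec] ED nonneg[OF D(1)] by simp
      show "Re (trace (?P * B)) + Re (trace (?E0 * B)) \<ge> 0"
        unfolding split[OF Bc] EB using nonneg[OF h(2)] by simp
    qed
  next
    assume ?operator
    then obtain E0 where E0: "psd m E0" "psd m (P_zero m ?D - E0)"
      and ge: "Re (trace (?P * A)) + Re (trace (E0 * A)) \<ge> Re (trace (?P * B)) + Re (trace (E0 * B))"
        "Re (trace (?P * B)) + Re (trace (E0 * B)) \<ge> 0" by blast
    have E0c: "E0 \<in> carrier_mat m m" using E0(1) by (rule psd_carrier)
    let ?E = "?P + E0"
    have Mp: "psd m (P_minus m ?D)"
    proof -
      obtain U e where U: "unitary m U" and De: "?D = spec_mat m U e" using hermitian_spectral[OF D(1)] by blast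
      show ?thesis unfolding De P_minus_spec_mat[OF U] by (rule spec_mat_psd[OF U]) simp
    qed
    \<comment> \<open>The identity is the sum of the three spectral projectors, so the complement of
      E consists of the negative part and of what \<open>E0\<close> leaves of
      \<open>P0\<close>.\<close>
    have "1\<^sub>m m - ?E = P_minus m ?D + (P_zero m ?D - E0)"
      unfolding P_zero_def using Pc psd_carrier[OF Mp] E0c by (intro eq_matI) auto
    hence E: "effect m ?E" using psd_add[OF Pp E0(1)] psd_add[OF Mp E0(2)] by (simp add: effect_def)
    let ?f = "binary_measurement m d ?E"
    \<comment> \<open>\<open>E0\<close> contributes nothing against D, so E is as good as the
      positive projector.\<close>
    have "Re (trace (?E * ?D)) = trace_norm m ?D / 2"
      using tr_sum[OF E0c, of ?D] hermitian_carrier[OF D(1)] trace_P_plus[OF D]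
        trace_effect_below_P_zero[OF D(1) E0] by simp
    moreover have "0 \<le> Re (trace (?E * B))" "Re (trace (?E * B)) \<le> Re (trace (?E * A))"
      using ge tr_sum[OF E0c Ac] tr_sum[OF E0c Bc] by auto
    moreover have "Re (trace (?E * ?D)) = Re (trace (?E * A)) - Re (trace (?E * B))"
      by (rule tr_diff) (use Pc E0c in auto)
    \<comment> \<open>The traces of E against A, B and D are all nonnegative, so the absolute values
      disappear and both equations become linear in these traces.\<close>
    ultimately show ?channel
      using trace_norm_binary_measurement[OF E assms(6)] binary_measurement_cptp[OF E assms(6)] assms D
      by (intro exI[of _ ?f]) simp
  qed
qed

end
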